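(* Let $1/2\le p<1$ be fixed, $q=1-p$, and let $H_n$ be the number of queries needed to recover the entire labeling in the Rényi process on $n$ objects with bias $p$ in which inconclusive queries are ignored. Then with high probability, as $n\to\infty$, $$H_n=\begin{cases}\log_{1/p} n+\tfrac12\log_{p/q}\log n+o(\log\log n), & p>q,\\[2pt] \log_2 n+\sqrt{2\log_2 n}+o(\sqrt{\log n}), & p=q.\end{cases}$$
   Context: Rényi process with bias $p$. Let $X$ be a set of $n$ objects, $A$ a set of $n$ labels and $\phi:X\to A$ a (hidden) bijection. Set $\mathcal P_0=\{X\}$. Inductively, given the partition $\mathcal P_{j-1}$ of $X$ ($j\ge1$), the $j$th query is a random set $Q_j\subseteq A$: each label is included independently with probability $p$, except that, independently for each $S\in\mathcal P_{j-1}$ with $|S|\ge 2$, the decisions for the labels of the objects of $S$ are redrawn with the same law until at least one label of $\phi(S)$ is included and at least one is not (so every non-singleton class is split nontrivially; equivalently, one conditions on this event). $\mathcal P_j$ is obtained from $\mathcal P_{j-1}$ by replacing every $S$ with $|S|\ge2$ by the two sets $S\cap\phi^{-1}(Q_j)$ and $S\setminus\phi^{-1}(Q_j)$; singletons stay. External profile: $B_{n,k}$ is the number of $x\in X$ such that $\{x\}\in\mathcal P_k$ and ($k=0$ or $\{x\}\notin\mathcal P_{k-1}$), i.e. the number of bijection elements revealed by the $k$th query. Then $H_n=\max\{k: B_{n,k}>0\}$. "With high probability $X_n=a_n+o(b_n)$" means that $(X_n-a_n)/b_n\to0$ in probability, i.e. for every $\varepsilon>0$, $\Pr[|X_n-a_n|>\varepsilon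 b_n]\to 0$. $\log$ is the natural logarithm. *)

theory Defs
  imports "HOL-Probability.Probability"
begin

text \<open>
  A query is a set of labels; a sequence \<open>q\<close> of queries is indexed from 1, so \<open>q 0\<close> is never used.
  The hidden bijection is \<open>\<phi>\<close>.  A query that fails to split a class \<open>S\<close> would leave the two sets
  \<open>S\<close> and \<open>{}\<close>; this has probability 0 in the process below.
\<close>

definition refine_partition :: "('a \<Rightarrow> 'b) \<Rightarrow> 'b set \<Rightarrow> 'a set set \<Rightarrow> 'a set set" where
  "refine_partition \<phi> Q P =
     (\<Union>S\<in>P. if card S \<ge> 2 then {S \<inter> \<phi> -` Q, S - \<phi> -` Q} else {S})"

primrec renyi_partition :: "'a set \<Rightarrow> ('a \<Rightarrow> 'b) \<Rightarrow> (nat \<Rightarrow> 'b set) \<Rightarrow> nat \<Rightarrow> 'a set set" where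
  "renyi_partition X \<phi> q 0 = {X}"
| "renyi_partition X \<phi> q (Suc k) = refine_partition \<phi> (q (Suc k)) (renyi_partition X \<phi> q k)"

definition bernoulli_subset_pmf :: "real \<Rightarrow> 'b set \<Rightarrow> 'b set pmf" where
  "bernoulli_subset_pmf p A = map_pmf (\<lambda>f. {a\<in>A. f a}) (Pi_pmf A False (\<lambda>_. bernoulli_pmf p))"

definition conclusive_queries :: "('a \<Rightarrow> 'b) \<Rightarrow> 'a set set \<Rightarrow> 'b set set" where
  "conclusive_queries \<phi> P =
     {Q. \<forall>S\<in>P. card S \<ge> 2 \<longrightarrow> \<phi> ` S \<inter> Q \<noteq> {} \<and> \<phi> ` S - Q \<noteq> {}}"

definition renyi_query_pmf :: "real \<Rightarrow> 'b set \<Rightarrow> ('a \<Rightarrow> 'b) \<Rightarrow> 'a set set \<Rightarrow> 'b set pmf" where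
  "renyi_query_pmf p A \<phi> P = cond_pmf (bernoulli_subset_pmf p A) (conclusive_queries \<phi> P)"

text \<open>
  The last clause says that, conditionally on the first \<open>k\<close> queries, query \<open>k + 1\<close> has law
  \<^const>\<open>renyi_query_pmf\<close> for the partition those queries produced.
\<close>

definition renyi_process ::
  "real \<Rightarrow> 'a set \<Rightarrow> 'b set \<Rightarrow> ('a \<Rightarrow> 'b) \<Rightarrow> 'w measure \<Rightarrow> (nat \<Rightarrow> 'w \<Rightarrow> 'b set) \<Rightarrow> bool" where
  "renyi_process p X A \<phi> M Q \<longleftrightarrow>
     prob_space M \<and>
     (\<forall>j\<ge>1. Q j \<in> M \<rightarrow>\<^sub>M count_space (Pow A)) \<and>
     (\<forall>k q. \<P>(\<omega> in M. \<forall>i\<in>{1..Suc k}. Q i \<omega> = q i) =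
        \<P>(\<omega> in M. \<forall>i\<in>{1..k}. Q i \<omega> = q i) *
          pmf (renyi_query_pmf p A \<phi> (renyi_partition X \<phi> q k)) (q (Suc k)))"

definition external_profile :: "'a set \<Rightarrow> ('a \<Rightarrow> 'b) \<Rightarrow> (nat \<Rightarrow> 'b set) \<Rightarrow> nat \<Rightarrow> nat" where
  "external_profile X \<phi> q k =
     card {x\<in>X. {x} \<in> renyi_partition X \<phi> q k \<and>
                (k = 0 \<or> {x} \<notin> renyi_partition X \<phi> q (k - 1))}"

definition renyi_height :: "'a set \<Rightarrow> ('a \<Rightarrow> 'b) \<Rightarrow> (nat \<Rightarrow> 'b set) \<Rightarrow> nat" where
  "renyi_height X \<phi> q = Max {k. external_profile X \<phi> q k > 0}"

text \<open>With high probability, \<open>Y n = a n + o(b n)\<close>.\<close>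

definition whp_eq_plus_smallo ::
  "(nat \<Rightarrow> 'w measure) \<Rightarrow> (nat \<Rightarrow> 'w \<Rightarrow> real) \<Rightarrow> (nat \<Rightarrow> real) \<Rightarrow> (nat \<Rightarrow> real) \<Rightarrow> bool" where
  "whp_eq_plus_smallo M Y a b \<longleftrightarrow>
     (\<forall>\<epsilon>>0. (\<lambda>n. \<P>(\<omega> in M n. \<bar>Y n \<omega> - a n\<bar> > \<epsilon> * b n)) \<longlonglongrightarrow> 0)"

subsection \<open>The process exists and its height is measurable\<close>

lemma renyi_partition_disjoint:
  "finite (renyi_partition X \<phi> q k) \<and> \<Union>(renyi_partition X \<phi> q k) \<subseteq> X \<and>
   (\<forall>S\<in>renyi_partition X \<phi> q k. \<forall>T\<in>renyi_partition X \<phi> q k. S \<inter> T \<noteq> {} \<longrightarrow> S = T)"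
proof (induction k)
  case (Suc k)
  let ?R = "\<lambda>S. if card S \<ge> 2 then {S \<inter> \<phi> -` q (Suc k), S - \<phi> -` q (Suc k)} else {S}"
  have sub: "U \<subseteq> S" if "U \<in> ?R S" for U S using that by (auto split: if_splits)
  have "S = T" if "S' \<in> renyi_partition X \<phi> q k" "T' \<in> renyi_partition X \<phi> q k"
      "S \<in> ?R S'" "T \<in> ?R T'" "S \<inter> T \<noteq> {}" for S T S' T'
  proof -
    have "S' \<inter> T' \<noteq> {}" using sub[OF that(3)] sub[OF that(4)] that(5) by blast
    hence "S' = T'" using Suc that by blast
    thus ?thesis using that(3,4,5) by (auto split: if_splits)
  qed
  moreover have "\<Union>(\<Union>S\<in>renyi_partition X \<phi> q k. ?R S) \<subseteq> X" using Suc sub by blast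
  moreover have "finite (\<Union>S\<in>renyi_partition X \<phi> q k. ?R S)" using Suc by auto
  ultimately show ?case unfolding renyi_partition.simps refine_partition_def by blast
qed auto

lemma set_bernoulli_subset_pmf:
  assumes "0 < p" "p < 1" "finite A"
  shows "set_pmf (bernoulli_subset_pmf p A) = Pow A"
proof -
  have "set_pmf (bernoulli_pmf p) = UNIV" using assms by simp
  hence "set_pmf (bernoulli_subset_pmf p A) =
      (\<lambda>f. {a\<in>A. f a}) ` PiE_dflt A False (\<lambda>_. UNIV)"
    using assms by (simp add: bernoulli_subset_pmf_def set_Pi_pmf)
  also have "\<dots> = Pow A"
  proof (intro equalityI subsetI)
    fix B assume "B \<in> Pow A"
    thus "B \<in> (\<lambda>f. {a\<in>A. f a}) ` PiE_dflt A False (\<lambda>_. UNIV)"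
      by (intro image_eqI[of _ _ "\<lambda>a. a \<in> B"]) (auto simp: PiE_dflt_def)
  qed auto
  finally show ?thesis .
qed

lemma ex_conclusive_query:
  assumes "bij_betw \<phi> X A"
  shows "\<exists>B\<subseteq>A. B \<in> conclusive_queries \<phi> (renyi_partition X \<phi> q k)"
proof -
  define P where "P = renyi_partition X \<phi> q k"
  have P: "S \<subseteq> X" "S \<in> P \<Longrightarrow> T \<in> P \<Longrightarrow> S \<inter> T \<noteq> {} \<Longrightarrow> S = T" if "S \<in> P" for S T
    using renyi_partition_disjoint[of X \<phi> q k] that unfolding P_def by blast+
  define x where "x = (\<lambda>S. SOME y::'a. y \<in> S)"
  have x: "x S \<in> S" if "card S \<ge> 2" for S
    using that unfolding x_def by (metis card.empty not_numeral_le_zero some_in_eq)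
  define B where "B = \<phi> ` x ` {S\<in>P. card S \<ge> 2}"
  have inj: "inj_on \<phi> X" and im: "\<phi> ` X = A" using assms by (auto simp: bij_betw_def)
  have "B \<subseteq> A" using x P(1) im unfolding B_def by blast
  moreover have "\<phi> ` S \<inter> B \<noteq> {} \<and> \<phi> ` S - B \<noteq> {}" if S: "S \<in> P" "card S \<ge> 2" for S
  proof -
    have "\<phi> (x S) \<in> \<phi> ` S \<inter> B" using x S unfolding B_def by blast
    moreover obtain y where y: "y \<in> S" "y \<noteq> x S"
    proof -
      have "\<not> S \<subseteq> {x S}" using S(2) card_mono[of "{x S}" S] by auto
      thus ?thesis using that by blast
    qed
    have "\<phi> y \<notin> B"
    proof
      assume "\<phi> y \<in> B"
      then obtain T where T: "T \<in> P" "card T \<ge> 2" "\<phi> y = \<phi> (x T)" unfolding B_def by blast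
      have "y \<in> X" "x T \<in> X" using y P(1)[OF S(1)] P(1)[OF T(1)] x[OF T(2)] by auto
      hence "y = x T" using T(3) inj by (auto dest: inj_onD)
      hence "S = T" using P(2)[OF S(1) S(1) T(1)] y(1) x[OF T(2)] by blast
      thus False using \<open>y = x T\<close> y by simp
    qed
    ultimately show ?thesis using y by blast
  qed
  ultimately show ?thesis unfolding P_def[symmetric] conclusive_queries_def by blast
qed

lemma set_renyi_query_pmf:
  assumes "0 < p" "p < 1" "finite A" "bij_betw \<phi> X A"
  shows "set_pmf (renyi_query_pmf p A \<phi> (renyi_partition X \<phi> q k)) =
           Pow A \<inter> conclusive_queries \<phi> (renyi_partition X \<phi> q k)"
  unfolding renyi_query_pmf_def
  using ex_conclusive_query[OF assms(4)] set_bernoulli_subset_pmf[OF assms(1-3)]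
  by (subst set_cond_pmf) blast+

lemma renyi_partition_cong:
  "(\<And>i. 1 \<le> i \<Longrightarrow> i \<le> k \<Longrightarrow> q i = q' i) \<Longrightarrow> renyi_partition X \<phi> q k = renyi_partition X \<phi> q' k"
  by (induction k) auto

text \<open>
  The sample space has one independent query for every possible finite history; the process reads
  off the query belonging to the history it has produced so far.
\<close>

lemma renyi_process_exists:
  fixes \<phi> :: "'a \<Rightarrow> 'b"
  assumes p: "0 < p" "p < 1" and A: "finite A" and \<phi>: "bij_betw \<phi> X A"
  shows "\<exists>(M :: ('b set list \<Rightarrow> 'b set) measure) Q. renyi_process p X A \<phi> M Q"
proof -
  define N where "N = (\<lambda>h :: 'b set list. measure_pmf
    (renyi_query_pmf p A \<phi> (renyi_partition X \<phi> (\<lambda>i. h ! (i - 1)) (length h))))"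
  interpret product_prob_space N UNIV
    unfolding product_prob_space_def product_sigma_finite_def product_prob_space_axioms_def N_def
    by (auto intro: measure_pmf.prob_space_axioms measure_pmf.sigma_finite_measure_axioms)
  define M where "M = PiM UNIV N"
  define hist where "hist = (\<lambda>\<omega> :: 'b set list \<Rightarrow> 'b set. rec_nat [] (\<lambda>_ h. h @ [A \<inter> \<omega> h]))"
  have hist: "hist \<omega> 0 = []" "hist \<omega> (Suc k) = hist \<omega> k @ [A \<inter> \<omega> (hist \<omega> k)]" for \<omega> k
    by (auto simp: hist_def)
  define Q where "Q = (\<lambda>j \<omega>. A \<inter> \<omega> (hist \<omega> (j - 1)))"
  have sN: "sets (N h) = UNIV" "space (N h) = UNIV" for h by (auto simp: N_def)
  have spM: "space M = UNIV" by (simp add: M_def space_PiM sN PiE_def)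
  have hist_Q: "hist \<omega> k = map (\<lambda>i. Q (Suc i) \<omega>) [0..<k]" for \<omega> k
    by (induction k) (auto simp: hist Q_def)
  have prefix: "(\<forall>i\<in>{1..k}. Q i \<omega> = q i) \<longleftrightarrow>
      (\<forall>i<k. A \<inter> \<omega> (map (\<lambda>i. q (Suc i)) [0..<i]) = q (Suc i))" for \<omega> k q
  proof (induction k)
    case (Suc k)
    have "hist \<omega> k = map (\<lambda>i. q (Suc i)) [0..<k]" if "\<forall>i\<in>{1..k}. Q i \<omega> = q i"
      unfolding hist_Q using that by auto
    moreover have "Q (Suc k) \<omega> = A \<inter> \<omega> (hist \<omega> k)" by (simp add: Q_def)
    moreover have "(\<forall>i\<in>{1..Suc k}. Q i \<omega> = q i) \<longleftrightarrow>
        (\<forall>i\<in>{1..k}. Q i \<omega> = q i) \<and> Q (Suc k) \<omega> = q (Suc k)"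
      by (subst atLeastAtMostSuc_conv) auto
    ultimately have "(\<forall>i\<in>{1..Suc k}. Q i \<omega> = q i) \<longleftrightarrow> (\<forall>i\<in>{1..k}. Q i \<omega> = q i) \<and>
        A \<inter> \<omega> (map (\<lambda>i. q (Suc i)) [0..<k]) = q (Suc k)"
      by metis
    thus ?case unfolding Suc All_less_Suc by (simp only: conj_commute)
  qed auto
  define J where "J = (\<lambda>q k. (\<lambda>i. map (\<lambda>i. q (Suc i) :: 'b set) [0..<i]) ` {..<k})"
  have J: "(\<forall>i<k. A \<inter> \<omega> (map (\<lambda>i. q (Suc i)) [0..<i]) = q (Suc i)) \<longleftrightarrow>
      (\<forall>h\<in>J q k. \<omega> h \<in> {B. A \<inter> B = q (Suc (length h))})" for \<omega> q k
    by (auto simp: J_def)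
  have injJ: "inj_on (\<lambda>i. map (\<lambda>i. q (Suc i) :: 'b set) [0..<i]) T" for q T
    by (rule inj_on_inverseI[of _ length]) simp
  have pref_emb: "{\<omega>\<in>space M. \<forall>i\<in>{1..k}. Q i \<omega> = q i} =
      prod_emb UNIV N (J q k) (PiE (J q k) (\<lambda>h. {B. A \<inter> B = q (Suc (length h))}))" for q k
    unfolding prefix J by (rule set_eqI) (simp add: prod_emb_def spM sN PiE_iff)
  have fin: "finite (J q k)" for q k by (simp add: J_def)
  have pref_sets: "{\<omega>\<in>space M. \<forall>i\<in>{1..k}. Q i \<omega> = q i} \<in> sets M" for q k
    unfolding pref_emb unfolding M_def by (rule sets_PiM_I) (auto simp: fin sN)
  have "measure M {\<omega>\<in>space M. \<forall>i\<in>{1..k}. Q i \<omega> = q i} =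
      (\<Prod>h\<in>J q k. measure (N h) {B. A \<inter> B = q (Suc (length h))})" for q k
    unfolding pref_emb unfolding M_def by (rule measure_PiM_emb) (auto simp: fin sN)
  also have "\<dots> q k = (\<Prod>i<k. measure (N (map (\<lambda>i. q (Suc i)) [0..<i])) {B. A \<inter> B = q (Suc i)})" for q k
    unfolding J_def by (subst prod.reindex[OF injJ]) simp
  also have "\<dots> q k = (\<Prod>i<k. pmf (renyi_query_pmf p A \<phi> (renyi_partition X \<phi> q i)) (q (Suc i)))" for q k
  proof (rule prod.cong[OF refl])
    fix i
    define r where "r = renyi_query_pmf p A \<phi> (renyi_partition X \<phi> q i)"
    have "renyi_partition X \<phi> (\<lambda>j. map (\<lambda>i. q (Suc i)) [0..<i] ! (j - 1)) i = renyi_partition X \<phi> q i"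
      by (rule renyi_partition_cong) auto
    hence "N (map (\<lambda>i. q (Suc i)) [0..<i]) = measure_pmf r" by (simp add: N_def r_def)
    moreover have "set_pmf r \<subseteq> Pow A" unfolding r_def set_renyi_query_pmf[OF p A \<phi>] by blast
    hence "measure_pmf.prob r {B. A \<inter> B = q (Suc i)} = measure_pmf.prob r {q (Suc i)}"
      by (intro measure_pmf.finite_measure_eq_AE) (auto simp: AE_measure_pmf_iff)
    ultimately show "measure (N (map (\<lambda>i. q (Suc i)) [0..<i])) {B. A \<inter> B = q (Suc i)} =
        pmf (renyi_query_pmf p A \<phi> (renyi_partition X \<phi> q i)) (q (Suc i))"
      by (simp add: r_def measure_pmf_single)
  qed
  finally have prob: "\<P>(\<omega> in M. \<forall>i\<in>{1..k}. Q i \<omega> = q i) =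
      (\<Prod>i<k. pmf (renyi_query_pmf p A \<phi> (renyi_partition X \<phi> q i)) (q (Suc i)))" for q k .
  have "Q j \<in> M \<rightarrow>\<^sub>M count_space (Pow A)" if "j \<ge> 1" for j
  proof (rule measurable_count_space_eq2[THEN iffD2], goal_cases)
    case 1 show ?case using A by simp
  next
    case 2
    have "Q j -` {B} \<inter> space M \<in> sets M" for B
    proof -
      let ?C = "{q. q \<in> PiE {1..j} (\<lambda>_. Pow A) \<and> q j = B}"
      have "Q i \<omega> \<in> Pow A" for i \<omega> by (auto simp: Q_def)
      hence "Q j -` {B} \<inter> space M =
          (\<Union>q\<in>?C. {\<omega>\<in>space M. \<forall>i\<in>{1..j}. Q i \<omega> = q i})"
        using that
      proof (intro equalityI subsetI, goal_cases)
        case (1 \<omega>)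
        thus ?case by (intro UN_I[of "restrict (\<lambda>i. Q i \<omega>) {1..j}"]) auto
      qed auto
      moreover have "finite ?C"
        by (rule finite_subset[of _ "PiE {1..j} (\<lambda>_. Pow A)"]) (auto intro!: finite_PiE simp: A)
      ultimately show ?thesis using pref_sets by auto
    qed
    thus ?case by (auto simp: Q_def)
  qed
  moreover have "prob_space M" unfolding M_def by (rule P.prob_space_axioms)
  ultimately have "renyi_process p X A \<phi> M Q" unfolding renyi_process_def prob by auto
  thus ?thesis by blast
qed

lemma measurable_renyi_height:
  assumes Q: "renyi_process p X A \<phi> M Q" and A: "finite A" and X: "finite X"
  shows "(\<lambda>\<omega>. renyi_height X \<phi> (\<lambda>j. Q j \<omega>)) \<in> M \<rightarrow>\<^sub>M count_space UNIV"
proof -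
  have Qm: "{\<omega>\<in>space M. Q j \<omega> = B} \<in> sets M" if "j \<ge> 1" for j B
  proof (cases "B \<subseteq> A")
    case True
    have "Q j -` {B} \<inter> space M \<in> sets M"
      using Q that True by (intro measurable_sets[of _ M "count_space (Pow A)"]) (auto simp: renyi_process_def)
    thus ?thesis by (simp add: vimage_def Collect_conj_eq Int_commute)
  next
    case False
    have "Q j \<in> space M \<rightarrow> Pow A"
      using Q that measurable_space[of "Q j" M "count_space (Pow A)"] by (auto simp: renyi_process_def)
    hence "{\<omega>\<in>space M. Q j \<omega> = B} = {}" using False by auto
    thus ?thesis by (simp only: sets.empty_sets)
  qed
  have E: "{\<omega>\<in>space M. R (renyi_partition X \<phi> (\<lambda>j. Q j \<omega>) k) (renyi_partition X \<phi> (\<lambda>j. Q j \<omega>) (k - 1))} \<in> sets M"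
    for R k
  proof -
    let ?C = "{q \<in> PiE {1..k} (\<lambda>_. Pow A). R (renyi_partition X \<phi> q k) (renyi_partition X \<phi> q (k - 1))}"
    have range: "Q i \<omega> \<in> Pow A" if "i \<ge> 1" "\<omega> \<in> space M" for i \<omega>
      using Q that measurable_space[of "Q i" M "count_space (Pow A)"] by (auto simp: renyi_process_def)
    have cong: "renyi_partition X \<phi> (\<lambda>j. Q j \<omega>) l = renyi_partition X \<phi> q l"
      if "\<forall>i\<in>{1..k}. Q i \<omega> = q i" "l \<le> k" for \<omega> q l
      using that by (intro renyi_partition_cong) auto
    have "{\<omega>\<in>space M. R (renyi_partition X \<phi> (\<lambda>j. Q j \<omega>) k) (renyi_partition X \<phi> (\<lambda>j. Q j \<omega>) (k - 1))} =
        (\<Union>q\<in>?C. {\<omega>\<in>space M. \<forall>i\<in>{1..k}. Q i \<omega> = q i})" (is "?L = ?R")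
    proof (intro equalityI subsetI)
      fix \<omega> assume w: "\<omega> \<in> ?L"
      define q where "q = restrict (\<lambda>i. Q i \<omega>) {1..k}"
      have a: "\<forall>i\<in>{1..k}. Q i \<omega> = q i" by (simp add: q_def)
      have "q \<in> PiE {1..k} (\<lambda>_. Pow A)" using w range by (auto simp: q_def)
      hence "q \<in> ?C" using w cong[OF a, of k] cong[OF a, of "k - 1"] by simp
      thus "\<omega> \<in> ?R" using w a by blast
    next
      fix \<omega> assume "\<omega> \<in> ?R"
      then obtain q where q: "q \<in> ?C" "\<omega> \<in> space M" "\<forall>i\<in>{1..k}. Q i \<omega> = q i" by blast
      thus "\<omega> \<in> ?L" using cong[OF q(3), of k] cong[OF q(3), of "k - 1"] by simp
    qed
    moreover have "finite ?C"
      by (rule finite_subset[of _ "PiE {1..k} (\<lambda>_. Pow A)"]) (auto intro!: finite_PiE simp: A)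
    moreover have "{\<omega>\<in>space M. \<forall>i\<in>{1..k}. Q i \<omega> = q i} \<in> sets M" for q
      by (intro sets.sets_Collect_finite_All) (auto intro: Qm)
    ultimately show ?thesis by auto
  qed
  have pos: "{\<omega>\<in>space M. external_profile X \<phi> (\<lambda>j. Q j \<omega>) k > 0} \<in> sets M" for k
    unfolding external_profile_def
    by (rule E[of "\<lambda>P P'. card {x\<in>X. {x} \<in> P \<and> (k = 0 \<or> {x} \<notin> P')} > 0"])
  define B where "B = (\<lambda>\<omega>. {k. external_profile X \<phi> (\<lambda>j. Q j \<omega>) k > 0})"
  have mono: "{x} \<in> renyi_partition X \<phi> q l" if "{x} \<in> renyi_partition X \<phi> q k" "k \<le> l" for x q k l
    using that(2,1) by (induction l rule: dec_induct) (auto simp: refine_partition_def intro!: bexI[of _ "{x}"])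
  have finB: "finite (B \<omega>)" for \<omega>
  proof -
    let ?q = "\<lambda>j. Q j \<omega>"
    let ?f = "\<lambda>x k. {x} \<in> renyi_partition X \<phi> ?q k \<and> (k = 0 \<or> {x} \<notin> renyi_partition X \<phi> ?q (k - 1))"
    have "False" if "?f x k" "?f x l" "k < l" for x k l
    proof -
      have "k \<le> l - 1" "l \<noteq> 0" using that by linarith+
      thus False using that mono[of x ?q k "l - 1"] by blast
    qed
    hence uniq: "k = l" if "?f x k" "?f x l" for x k l
      using that by (metis linorder_neqE_nat)
    have "\<exists>x\<in>X. ?f x k" if "k \<in> B \<omega>" for k
      using that unfolding B_def external_profile_def by (auto simp: card_gt_0_iff)
    moreover have "(THE k. ?f x k) = k" if "?f x k" for x k
      by (rule the_equality) (fact that, rule uniq[OF _ that])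
    ultimately have "B \<omega> \<subseteq> (\<lambda>x. THE k. ?f x k) ` X"
      by (metis (no_types, lifting) imageI subsetI)
    thus ?thesis using X finite_surj by blast
  qed
  have max: "Max (B \<omega>) = m \<longleftrightarrow> (B \<omega> = {} \<and> Max ({} :: nat set) = m) \<or> (m \<in> B \<omega> \<and> (\<forall>k>m. k \<notin> B \<omega>))" for \<omega> m
    using finB[of \<omega>] Max_eq_iff[of "B \<omega>" m] by (cases "B \<omega> = {}") (simp, metis leD leI)
  have [measurable]: "Measurable.pred M (\<lambda>\<omega>. k \<in> B \<omega>)" for k
    using pos[of k] by (simp add: pred_def B_def)
  have eqm: "Measurable.pred M (\<lambda>\<omega>. Max (B \<omega>) = m)" for m
    unfolding max set_eq_iff[of _ "{}"] empty_iff by measurable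
  have "renyi_height X \<phi> (\<lambda>j. Q j \<omega>) = Max (B \<omega>)" for \<omega>
    by (simp add: renyi_height_def B_def)
  thus ?thesis
    using eqm by (intro measurable_count_space_eq_countable[THEN iffD2])
      (auto simp: pred_def vimage_def Int_def conj_commute)
qed

end

theory Submission
  imports Defs "HOL-Real_Asymp.Real_Asymp"
begin

text \<open>
  A query splits a class of \<open>m \<ge> 2\<close> objects into parts of sizes \<open>j\<close> and \<open>m - j\<close>, where \<open>j\<close> is binomial
  with parameters \<open>m, p\<close> conditioned on \<open>0 < j < m\<close>, and different classes split independently. So the
  probability \<open>height_cdf k m\<close> that \<open>k\<close> queries resolve a class of \<open>m\<close> objects into singletons satisfies
  a numerical recursion, and it is the distribution function of the height (\<open>prob_height_le\<close>). The
  theorem becomes a statement about this recursion: find levels within the allowed error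
  of the claimed height at which \<open>height_cdf\<close> tends to 1 and to 0, respectively.

  Upper bound (\<open>exceedance_bound\<close>). The binomial moment \<open>m choose s\<close> of a class size shrinks in mean by
  the factor \<open>p ^ s + q ^ s\<close> when the class is split and both parts are counted; conditioning on a
  nontrivial split only helps. On the other hand, a class that is still
  unresolved after \<open>y\<close> queries had at least \<open>s = y + 2\<close> objects, because each query detaches at least one
  object. Using the moment of order \<open>s\<close> for \<open>k\<close> queries and then moments of decreasing order
  \<open>s - 1, ..., 2\<close> during the last \<open>y\<close> queries bounds the probability of being unresolved by
  \<open>n ^ s * (p ^ s + q ^ s) ^ k\<close> times the product of \<open>p ^ i + q ^ i\<close> over \<open>2 \<le> i < s\<close>.
  Let \<open>l\<close> be the logarithm of \<open>ln n\<close> to base \<open>p / q\<close>. If \<open>p > q\<close>, take \<open>s\<close> close to \<open>l\<close>: then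
  \<open>(1 + (q / p) ^ s) ^ k\<close> stays bounded and, at level \<open>k + s = log (1/p) n + x\<close>, the bound is about
  \<open>p\<close> to the power \<open>s * (x - s / 2)\<close>, which is small as soon as \<open>x\<close> exceeds \<open>l / 2\<close> noticeably. If
  \<open>p = q\<close>, at level \<open>log 2 n + x\<close> and with \<open>s\<close> close to \<open>x\<close> the bound is about \<open>n\<close> times 2 to the power
  \<open>- x\<^sup>2 / 2\<close>, which is small once \<open>x\<close> exceeds \<open>sqrt (2 * log 2 n)\<close> noticeably.

  Lower bound (\<open>height_cdf_le_band\<close>). After \<open>i\<close> queries there are \<open>i choose j\<close> classes whose objects were
  excluded from exactly \<open>j\<close> of the queries; by Hoeffding's inequality their sizes stay close to
  \<open>n * p ^ (i - j) * q ^ j\<close>, and \<open>i\<close> is chosen so that this size is large enough for concentration, but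
  so small that its logarithm is negligible against the allowed error. Each of them independently
  stays unresolved for \<open>y\<close> further queries with probability at least
  \<open>tall_prob y\<close>, roughly \<open>p\<close> to the power \<open>y\<^sup>2 / 2\<close>, since it may shrink by a single object at
  a time (\<open>height_cdf_le_tall_prob\<close>). A tall subtree therefore appears once the number of classes
  outweighs this probability. If \<open>p = q\<close>, almost \<open>n\<close> classes of equal size are available, which pays
  for \<open>y\<close> close to \<open>sqrt (2 * log 2 n)\<close>. If \<open>p > q\<close>, choosing \<open>j\<close> proportional to \<open>ln (ln n)\<close> costs
  \<open>j * log (1/p) (p/q)\<close> levels, since the classes are smaller, and yields about \<open>(ln n) ^ j\<close> of them.
  The best balance is a cost of \<open>l / 2\<close> levels, which pays for \<open>y\<close> close to \<open>l\<close>; the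
  net gain \<open>l / 2\<close> is the second term of the claim.
\<close>

section \<open>The recursion for the height\<close>

locale bias =
  fixes p q :: real
  assumes p_pos: "0 < p" and q_pos: "0 < q" and p_plus_q: "p + q = 1"
begin

text \<open>
  The binomial weights in both parameters \<open>p\<close> and \<open>q\<close>, so that interchanging the roles of included
  and excluded objects is an instance of the same locale.
\<close>

definition bin_weight :: "nat \<Rightarrow> nat \<Rightarrow> real" where
  "bin_weight m j = real (m choose j) * p ^ j * q ^ (m - j)"

text \<open>
  The probability that an unconditioned query splits a class of \<open>m \<ge> 1\<close> objects nontrivially.
\<close>

definition split_norm :: "nat \<Rightarrow> real" where
  "split_norm m = 1 - p ^ m - q ^ m"

text \<open>
  The probability that a class of \<open>m\<close> objects consists of singletons (or is empty) after \<open>k\<close>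
  queries: after a nontrivial split, both parts have to be resolved, independently, by the
  remaining queries.
\<close>

primrec height_cdf :: "nat \<Rightarrow> nat \<Rightarrow> real" where
  "height_cdf 0 = (\<lambda>m. if m \<le> 1 then 1 else 0)"
| "height_cdf (Suc k) = (\<lambda>m. if m \<le> 1 then 1 else
     (\<Sum>j\<in>{0<..<m}. bin_weight m j * (height_cdf k j * height_cdf k (m - j))) / split_norm m)"

lemma p_less_1: "p < 1" and q_less_1: "q < 1" and q_eq: "q = 1 - p"
  using p_pos q_pos p_plus_q by auto

lemma bin_weight_nonneg: "bin_weight m j \<ge> 0"
  using p_pos q_pos by (simp add: bin_weight_def)

lemma sum_bin_weight_atMost: "(\<Sum>j\<le>m. bin_weight m j) = 1"
  using binomial_ring[of p q m] p_plus_q by (simp add: bin_weight_def)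

lemma sum_atMost_split_ends:
  fixes f :: "nat \<Rightarrow> real"
  assumes "m \<ge> 1"
  shows "(\<Sum>j\<le>m. f j) = f 0 + f m + (\<Sum>j\<in>{0<..<m}. f j)"
proof -
  have "{..m} = insert 0 (insert m {0<..<m})" using assms by auto
  thus ?thesis using assms by simp
qed

lemma sum_bin_weight:
  assumes "m \<ge> 1"
  shows "(\<Sum>j\<in>{0<..<m}. bin_weight m j) = split_norm m"
  using sum_atMost_split_ends[OF assms, of "bin_weight m"] sum_bin_weight_atMost[of m]
  by (simp add: bin_weight_def split_norm_def)

lemma split_norm_ge:
  assumes "m \<ge> 2"
  shows "split_norm m \<ge> 2 * p * q"
proof -
  have "p ^ m \<le> p ^ 2" "q ^ m \<le> q ^ 2"
    using assms p_pos q_pos p_less_1 q_less_1 by (intro power_decreasing; simp)+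
  moreover have "(p + q) ^ 2 = 1" using p_plus_q by simp
  ultimately show ?thesis
    by (simp add: split_norm_def power2_sum)
qed

lemma split_norm_pos: "m \<ge> 2 \<Longrightarrow> split_norm m > 0"
  using split_norm_ge[of m] p_pos q_pos by (smt (verit) mult_pos_pos)

lemma split_norm_le_1: "split_norm m \<le> 1"
  using zero_less_power[OF p_pos, of m] zero_less_power[OF q_pos, of m] by (simp add: split_norm_def)

lemma height_cdf_trivial [simp]: "m \<le> 1 \<Longrightarrow> height_cdf k m = 1"
  by (cases k) auto

lemma height_cdf_Suc:
  assumes "m \<ge> 2"
  shows "height_cdf (Suc k) m =
    (\<Sum>j\<in>{0<..<m}. bin_weight m j * (height_cdf k j * height_cdf k (m - j))) / split_norm m"
  using assms by simp

declare height_cdf.simps(2) [simp del]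

lemma height_cdf_bounds: "0 \<le> height_cdf k m \<and> height_cdf k m \<le> 1"
proof (induction k arbitrary: m)
  case (Suc k)
  show ?case
  proof (cases "m \<ge> 2")
    case True
    have "(\<Sum>j\<in>{0<..<m}. bin_weight m j * (height_cdf k j * height_cdf k (m - j)))
        \<le> (\<Sum>j\<in>{0<..<m}. bin_weight m j * 1)"
      using Suc bin_weight_nonneg
      by (intro sum_mono mult_left_mono) (auto intro: mult_le_one)
    also have "\<dots> = split_norm m" using sum_bin_weight True by simp
    moreover have "(\<Sum>j\<in>{0<..<m}. bin_weight m j * (height_cdf k j * height_cdf k (m - j))) \<ge> 0"
      using Suc bin_weight_nonneg by (intro sum_nonneg) auto
    ultimately show ?thesis
      using True split_norm_pos[OF True] by (simp add: height_cdf_Suc)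
  qed auto
qed auto

lemma height_cdf_nonneg: "0 \<le> height_cdf k m" and height_cdf_le_1: "height_cdf k m \<le> 1"
  using height_cdf_bounds by auto

text \<open>
  Each query detaches at least one object from every unresolved class, so \<open>m - 1\<close> queries always
  suffice.
\<close>

lemma height_cdf_eq_1:
  assumes "m \<le> k + 1"
  shows "height_cdf k m = 1"
  using assms
proof (induction k arbitrary: m)
  case (Suc k)
  show ?case
  proof (cases "m \<ge> 2")
    case True
    have "(\<Sum>j\<in>{0<..<m}. bin_weight m j * (height_cdf k j * height_cdf k (m - j))) =
        (\<Sum>j\<in>{0<..<m}. bin_weight m j)"
      using Suc by (intro sum.cong) auto
    thus ?thesis
      using True split_norm_pos[OF True] sum_bin_weight[of m] by (simp add: height_cdf_Suc)
  qed auto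
qed auto

lemma one_minus_height_cdf_Suc:
  assumes "m \<ge> 2"
  shows "1 - height_cdf (Suc k) m =
    (\<Sum>j\<in>{0<..<m}. bin_weight m j * (1 - height_cdf k j * height_cdf k (m - j))) / split_norm m"
  using assms split_norm_pos[OF assms] sum_bin_weight[of m]
  by (simp add: height_cdf_Suc right_diff_distrib sum_subtractf diff_divide_distrib)

end

section \<open>Independence of the classes\<close>

lemma sum_Pow_by_card:
  fixes g :: "nat \<Rightarrow> real"
  assumes "finite S"
  shows "(\<Sum>B\<in>Pow S. g (card B)) = (\<Sum>j\<le>card S. real (card S choose j) * g j)"
proof -
  have "(\<Sum>B\<in>Pow S. g (card B)) = (\<Sum>j\<in>{..card S}. \<Sum>B\<in>{B\<in>Pow S. card B = j}. g (card B))"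
    using assms by (intro sum.group[symmetric]) (auto intro: card_mono)
  also have "\<dots> = (\<Sum>j\<le>card S. real (card S choose j) * g j)"
  proof (intro sum.cong refl)
    fix j
    have "{B\<in>Pow S. card B = j} = {B. B \<subseteq> S \<and> card B = j}" by auto
    thus "(\<Sum>B\<in>{B\<in>Pow S. card B = j}. g (card B)) = real (card S choose j) * g j"
      using n_subsets[OF assms, of j] by simp
  qed
  finally show ?thesis .
qed

context bias
begin

definition subset_weight :: "'b set \<Rightarrow> 'b set \<Rightarrow> real" where
  "subset_weight A B = p ^ card B * q ^ card (A - B)"

lemma pmf_bernoulli_subset:
  fixes A :: "'b set"
  assumes "finite A" "B \<subseteq> A"
  shows "pmf (bernoulli_subset_pmf p A) B = subset_weight A B"
proof -
  let ?D = "PiE_dflt A False (\<lambda>_. UNIV :: bool set)"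
  have sup: "set_pmf (Pi_pmf A False (\<lambda>_. bernoulli_pmf p)) = ?D"
    using assms p_pos p_less_1 by (simp add: set_Pi_pmf)
  have inj: "inj_on (\<lambda>f. {a\<in>A. f a}) ?D"
    by (rule inj_onI, rule ext) (unfold PiE_dflt_def set_eq_iff mem_Collect_eq, metis)
  have mem: "(\<lambda>a. a \<in> B) \<in> ?D" using assms by (auto simp: PiE_dflt_def)
  have "B = {a\<in>A. a \<in> B}" using assms by auto
  hence "pmf (bernoulli_subset_pmf p A) B = pmf (Pi_pmf A False (\<lambda>_. bernoulli_pmf p)) (\<lambda>a. a \<in> B)"
    unfolding bernoulli_subset_pmf_def
    using pmf_map_inj[of "\<lambda>f. {a\<in>A. f a}" "Pi_pmf A False (\<lambda>_. bernoulli_pmf p)" "\<lambda>a. a \<in> B"] inj mem sup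
    by simp
  also have "\<dots> = (\<Prod>a\<in>A. if a \<in> B then p else q)"
    using assms p_pos p_less_1 q_eq by (subst pmf_Pi) (auto intro!: prod.cong)
  also have "\<dots> = (\<Prod>a\<in>A \<inter> B. p) * (\<Prod>a\<in>A - B. q)"
    using assms(1) by (simp add: prod.If_cases Diff_eq)
  also have "A \<inter> B = B" using assms by auto
  finally show ?thesis by (simp add: subset_weight_def)
qed

lemma sum_subset_weight_by_card:
  fixes S :: "'b set"
  assumes "finite S"
  shows "(\<Sum>B\<in>Pow S. subset_weight S B * g (card B)) = (\<Sum>j\<le>card S. bin_weight (card S) j * g j)"
proof -
  have "(\<Sum>B\<in>Pow S. subset_weight S B * g (card B)) =
      (\<Sum>B\<in>Pow S. p ^ card B * q ^ (card S - card B) * g (card B))"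
    using assms by (intro sum.cong) (auto simp: subset_weight_def card_Diff_subset finite_subset)
  also have "\<dots> = (\<Sum>j\<le>card S. real (card S choose j) * (p ^ j * q ^ (card S - j) * g j))"
    using sum_Pow_by_card[OF assms, of "\<lambda>j. p ^ j * q ^ (card S - j) * g j"] by simp
  finally show ?thesis by (simp add: bin_weight_def mult_ac)
qed

text \<open>
  A Bernoulli subset restricts to independent Bernoulli subsets of the disjoint sets \<open>L i\<close>. The
  expectation of a product of functions of these restrictions therefore factorizes.
\<close>

lemma sum_subset_weight_prod:
  fixes A :: "'b set" and L :: "'i \<Rightarrow> 'b set"
  assumes "finite I" "finite A" "\<And>i. i \<in> I \<Longrightarrow> L i \<subseteq> A"
    and "\<And>i j. i \<in> I \<Longrightarrow> j \<in> I \<Longrightarrow> i \<noteq> j \<Longrightarrow> L i \<inter> L j = {}"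
  shows "(\<Sum>B\<in>Pow A. subset_weight A B * (\<Prod>i\<in>I. h i (B \<inter> L i))) =
    (\<Prod>i\<in>I. \<Sum>B\<in>Pow (L i). subset_weight (L i) B * h i B)"
  using assms
proof (induction I arbitrary: A rule: finite_induct)
  case empty
  show ?case
    using sum_subset_weight_by_card[of A "\<lambda>_. 1"] empty by (simp add: sum_bin_weight_atMost)
next
  case (insert k I)
  have kA: "L k \<subseteq> A" and fin: "finite (L k)" "finite (A - L k)"
    using insert.prems(1,2) finite_subset[of "L k" A] by auto
  have "(\<Sum>B\<in>Pow A. subset_weight A B * (\<Prod>i\<in>insert k I. h i (B \<inter> L i))) =
      (\<Sum>(B1, B2)\<in>Pow (L k) \<times> Pow (A - L k).
        subset_weight A (B1 \<union> B2) * (\<Prod>i\<in>insert k I. h i ((B1 \<union> B2) \<inter> L i)))"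
    by (rule sum.reindex_bij_witness[of _ "\<lambda>(B1, B2). B1 \<union> B2" "\<lambda>B. (B \<inter> L k, B - L k)"])
       (use kA in \<open>auto simp: Int_Diff_Un\<close>)
  also have "\<dots> = (\<Sum>(B1, B2)\<in>Pow (L k) \<times> Pow (A - L k).
        (subset_weight (L k) B1 * h k B1) * (subset_weight (A - L k) B2 * (\<Prod>i\<in>I. h i (B2 \<inter> L i))))"
  proof (intro sum.cong refl, clarify)
    fix B1 B2 assume B: "B1 \<subseteq> L k" "B2 \<subseteq> A - L k"
    have f: "finite B1" "finite B2" using B fin finite_subset by metis+
    have "card (B1 \<union> B2) = card B1 + card B2" using B f by (intro card_Un_disjoint) auto
    moreover have "A - (B1 \<union> B2) = (L k - B1) \<union> (A - L k - B2)" using B kA by auto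
    moreover have "card ((L k - B1) \<union> (A - L k - B2)) = card (L k - B1) + card (A - L k - B2)"
      using fin by (intro card_Un_disjoint) auto
    ultimately have w: "subset_weight A (B1 \<union> B2) = subset_weight (L k) B1 * subset_weight (A - L k) B2"
      by (simp add: subset_weight_def power_add)
    have "(B1 \<union> B2) \<inter> L i = B2 \<inter> L i" if "i \<in> I" for i
    proof -
      have "k \<noteq> i" using that insert.hyps by auto
      hence "L k \<inter> L i = {}" using that insert.prems(3)[of k i] by simp
      thus ?thesis using B by auto
    qed
    hence "(\<Prod>i\<in>I. h i ((B1 \<union> B2) \<inter> L i)) = (\<Prod>i\<in>I. h i (B2 \<inter> L i))"
      by (intro prod.cong) auto
    moreover have "(B1 \<union> B2) \<inter> L k = B1" using B by auto
    ultimately show "subset_weight A (B1 \<union> B2) * (\<Prod>i\<in>insert k I. h i ((B1 \<union> B2) \<inter> L i)) =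
        subset_weight (L k) B1 * h k B1 * (subset_weight (A - L k) B2 * (\<Prod>i\<in>I. h i (B2 \<inter> L i)))"
      using insert.hyps by (simp add: w)
  qed
  also have "\<dots> = (\<Sum>B\<in>Pow (L k). subset_weight (L k) B * h k B) *
      (\<Sum>B\<in>Pow (A - L k). subset_weight (A - L k) B * (\<Prod>i\<in>I. h i (B \<inter> L i)))"
    by (simp add: sum_product sum.cartesian_product)
  also have "(\<Sum>B\<in>Pow (A - L k). subset_weight (A - L k) B * (\<Prod>i\<in>I. h i (B \<inter> L i))) =
      (\<Prod>i\<in>I. \<Sum>B\<in>Pow (L i). subset_weight (L i) B * h i B)"
  proof (rule insert.IH)
    fix i assume "i \<in> I"
    moreover from this have "k \<noteq> i" using insert.hyps by auto
    ultimately have "L k \<inter> L i = {}" "L i \<subseteq> A" using insert.prems(2)[of i] insert.prems(3)[of k i] by simp_all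
    thus "L i \<subseteq> A - L k" by auto
  qed (use insert.prems fin in auto)
  finally show ?case using insert.hyps by simp
qed

section \<open>One query\<close>

lemma sum_split_by_card:
  fixes S :: "'b set"
  assumes "finite S" "card S \<ge> 2"
  shows "(\<Sum>B\<in>Pow S. subset_weight S B * (if 0 < card B \<and> card B < card S then g (card B) else 0)) =
    (\<Sum>j\<in>{0<..<card S}. bin_weight (card S) j * g j)"
proof -
  have "(\<Sum>B\<in>Pow S. subset_weight S B * (if 0 < card B \<and> card B < card S then g (card B) else 0)) =
      (\<Sum>j\<le>card S. bin_weight (card S) j * (if 0 < j \<and> j < card S then g j else 0))"
    using sum_subset_weight_by_card[OF assms(1), of "\<lambda>j. if 0 < j \<and> j < card S then g j else 0"] by simp
  also have "\<dots> = (\<Sum>j\<in>{0<..<card S}. bin_weight (card S) j * g j)"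
    by (intro sum.mono_neutral_cong_right) auto
  finally show ?thesis .
qed

text \<open>
  The event of being conclusive is itself a product over the classes of \<open>P\<close>, so numerator and
  denominator of the conditional expectation both factorize, and the quotient for a class of
  size \<open>m\<close> is exactly the recursion of \<^const>\<open>height_cdf\<close>. Empty sets are allowed in \<open>P\<close>: they
  are never split and contribute the factor 1.
\<close>

lemma renyi_query_step:
  fixes \<phi> :: "'a \<Rightarrow> 'b" and P :: "'a set set"
  assumes X: "finite X" and A: "finite A" and bij: "bij_betw \<phi> X A"
    and P: "finite P" "\<Union>P \<subseteq> X" "\<And>S T. S \<in> P \<Longrightarrow> T \<in> P \<Longrightarrow> S \<inter> T \<noteq> {} \<Longrightarrow> S = T"
    and ex: "\<exists>B\<subseteq>A. B \<in> conclusive_queries \<phi> P"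
  shows "(\<Sum>B\<in>Pow A. pmf (renyi_query_pmf p A \<phi> P) B *
      (\<Prod>T\<in>refine_partition \<phi> B P. height_cdf k (card T))) = (\<Prod>S\<in>P. height_cdf (Suc k) (card S))"
proof -
  let ?C = "conclusive_queries \<phi> P"
  let ?\<mu> = "bernoulli_subset_pmf p A"
  \<comment> \<open>\<open>c S\<close> indicates that the query splits \<open>S\<close> properly; \<open>h S\<close> is \<open>c S\<close> times the contribution of
    the parts of \<open>S\<close>. Both depend only on the labels of \<open>S\<close>, and neutral values are used for
    classes that are not split.\<close>
  define c :: "'a set \<Rightarrow> 'b set \<Rightarrow> real" where
    "c = (\<lambda>S B. if card S \<ge> 2 then (if 0 < card B \<and> card B < card S then 1 else 0) else 1)"
  define h where "h = (\<lambda>(S :: 'a set) (B :: 'b set). if card S \<ge> 2 then (if 0 < card B \<and> card B < card S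
    then height_cdf k (card B) * height_cdf k (card S - card B) else 0) else 1)"
  have inj: "inj_on \<phi> X" and im: "\<phi> ` X = A" using bij by (auto simp: bij_betw_def)
  have finS: "finite S" and injS: "inj_on \<phi> S" and cardS: "card (\<phi> ` S) = card S" and LA: "\<phi> ` S \<subseteq> A" if "S \<in> P" for S
  proof -
    have S: "S \<subseteq> X" using P(2) that by auto
    show "finite S" using S X finite_subset by auto
    show "inj_on \<phi> S" using S inj inj_on_subset by blast
    thus "card (\<phi> ` S) = card S" by (rule card_image)
    show "\<phi> ` S \<subseteq> A" using S im by auto
  qed
  have part: "card (S \<inter> \<phi> -` B) = card (B \<inter> \<phi> ` S)" "card (S - \<phi> -` B) = card S - card (B \<inter> \<phi> ` S)"
    if "S \<in> P" for S B
  proof -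
    have "\<phi> ` (S \<inter> \<phi> -` B) = B \<inter> \<phi> ` S" by auto
    moreover have "inj_on \<phi> (S \<inter> \<phi> -` B)" using injS[OF that] by (rule inj_on_subset) auto
    ultimately show 1: "card (S \<inter> \<phi> -` B) = card (B \<inter> \<phi> ` S)" using card_image by metis
    have "card (S - \<phi> -` B) = card S - card (S \<inter> \<phi> -` B)"
      using finS[OF that] by (simp add: card_Diff_subset_Int)
    thus "card (S - \<phi> -` B) = card S - card (B \<inter> \<phi> ` S)" using 1 by simp
  qed
  have conclusive: "\<phi> ` S \<inter> B \<noteq> {} \<and> \<phi> ` S - B \<noteq> {} \<longleftrightarrow> 0 < card (B \<inter> \<phi> ` S) \<and> card (B \<inter> \<phi> ` S) < card S"
    if "S \<in> P" for S B
  proof -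
    have f: "finite (\<phi> ` S)" using finS[OF that] by simp
    have "\<phi> ` S \<inter> B \<noteq> {} \<longleftrightarrow> 0 < card (B \<inter> \<phi> ` S)" using f by (auto simp: card_gt_0_iff)
    moreover have "\<phi> ` S - B \<noteq> {} \<longleftrightarrow> card (B \<inter> \<phi> ` S) < card (\<phi> ` S)"
    proof
      assume "\<phi> ` S - B \<noteq> {}"
      hence "B \<inter> \<phi> ` S \<subset> \<phi> ` S" by auto
      thus "card (B \<inter> \<phi> ` S) < card (\<phi> ` S)" by (rule psubset_card_mono[OF f])
    next
      assume lt: "card (B \<inter> \<phi> ` S) < card (\<phi> ` S)"
      show "\<phi> ` S - B \<noteq> {}"
      proof
        assume "\<phi> ` S - B = {}"
        hence "B \<inter> \<phi> ` S = \<phi> ` S" by auto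
        thus False using lt by simp
      qed
    qed
    ultimately show ?thesis using cardS[OF that] by simp
  qed
  have memC: "B \<in> ?C \<longleftrightarrow> (\<forall>S\<in>P. card S \<ge> 2 \<longrightarrow> 0 < card (B \<inter> \<phi> ` S) \<and> card (B \<inter> \<phi> ` S) < card S)" for B
    unfolding conclusive_queries_def using conclusive by auto
  have prod_c: "(\<Prod>S\<in>P. c S (B \<inter> \<phi> ` S)) = (if B \<in> ?C then 1 else 0)" for B
    unfolding memC c_def using P(1) by (auto simp: prod_zero_iff intro!: prod.neutral)
  have prod_h: "(if B \<in> ?C then \<Prod>T\<in>refine_partition \<phi> B P. height_cdf k (card T) else 0) =
      (\<Prod>S\<in>P. h S (B \<inter> \<phi> ` S))" for B
  proof (cases "B \<in> ?C")
    case True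
    let ?R = "\<lambda>S. if card S \<ge> 2 then {S \<inter> \<phi> -` B, S - \<phi> -` B} else {S}"
    have B: "0 < card (B \<inter> \<phi> ` S)" "card (B \<inter> \<phi> ` S) < card S" if "S \<in> P" "card S \<ge> 2" for S
      using True that unfolding memC by auto
    have ne: "S = {}" if "S \<in> P" "{} \<in> ?R S" for S
    proof (rule ccontr)
      assume "S \<noteq> {}"
      hence c2: "card S \<ge> 2" using that(2) by (auto split: if_splits)
      hence "S \<inter> \<phi> -` B = {} \<or> S - \<phi> -` B = {}" using that(2) by auto
      hence "card (S \<inter> \<phi> -` B) = 0 \<or> card (S - \<phi> -` B) = 0" by (metis card.empty)
      thus False using part[OF that(1)] B[OF that(1) c2] by auto
    qed
    have sub: "T \<subseteq> S" if "T \<in> ?R S" for T S using that by (auto split: if_splits)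
    \<comment> \<open>The union over \<open>S \<in> P\<close> is a union of sets, so no part may arise twice; only the empty
      set could, and a conclusive query creates no empty part.\<close>
    have "?R S \<inter> ?R S' = {}" if "S \<in> P" "S' \<in> P" "S \<noteq> S'" for S S'
    proof (rule ccontr)
      assume "?R S \<inter> ?R S' \<noteq> {}"
      then obtain T where T: "T \<in> ?R S" "T \<in> ?R S'" by blast
      hence "T \<subseteq> S \<inter> S'" using sub by blast
      hence "T = {}" using P(3)[OF that(1,2)] that(3) by blast
      thus False using ne[OF that(1)] ne[OF that(2)] T that(3) by metis
    qed
    hence "(\<Prod>T\<in>refine_partition \<phi> B P. height_cdf k (card T)) = (\<Prod>S\<in>P. \<Prod>T\<in>?R S. height_cdf k (card T))"
      unfolding refine_partition_def using P(1) by (intro prod.UNION_disjoint) auto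
    also have "\<dots> = (\<Prod>S\<in>P. h S (B \<inter> \<phi> ` S))"
    proof (intro prod.cong refl)
      fix S assume S: "S \<in> P"
      show "(\<Prod>T\<in>?R S. height_cdf k (card T)) = h S (B \<inter> \<phi> ` S)"
      proof (cases "card S \<ge> 2")
        case c2: True
        have "S \<inter> \<phi> -` B \<noteq> {}" using part(1)[OF S, of B] B(1)[OF S c2] by (metis card.empty less_irrefl)
        hence "S \<inter> \<phi> -` B \<noteq> S - \<phi> -` B" by blast
        thus ?thesis using c2 B[OF S c2] part[OF S, of B] by (simp add: h_def)
      qed (simp add: h_def)
    qed
    finally show ?thesis using True by simp
  next
    case False
    then obtain S where "S \<in> P" "h S (B \<inter> \<phi> ` S) = 0" unfolding memC h_def by auto
    thus ?thesis using False P(1) by (auto intro!: prod_zero[symmetric])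
  qed
  have disj: "\<phi> ` S \<inter> \<phi> ` T = {}" if "S \<in> P" "T \<in> P" "S \<noteq> T" for S T
  proof -
    have "S \<inter> T = {}" using P(3) that by auto
    moreover have "\<phi> ` (S \<inter> T) = \<phi> ` S \<inter> \<phi> ` T"
      using P(2) that by (intro inj_on_image_Int[OF inj]) auto
    ultimately show ?thesis by simp
  qed
  have fact: "(\<Sum>B\<in>Pow A. subset_weight A B * (\<Prod>S\<in>P. f S (B \<inter> \<phi> ` S))) =
      (\<Prod>S\<in>P. \<Sum>B\<in>Pow (\<phi> ` S). subset_weight (\<phi> ` S) B * f S B)" for f :: "'a set \<Rightarrow> 'b set \<Rightarrow> real"
    by (rule sum_subset_weight_prod[OF P(1) A LA disj])
  have sC: "set_pmf ?\<mu> \<inter> ?C \<noteq> {}"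
    using ex set_bernoulli_subset_pmf[OF p_pos p_less_1 A] by auto
  have "measure_pmf.prob ?\<mu> ?C = measure_pmf.prob ?\<mu> (?C \<inter> Pow A)"
    using set_bernoulli_subset_pmf[OF p_pos p_less_1 A] by (metis measure_Int_set_pmf)
  also have "\<dots> = (\<Sum>B\<in>?C \<inter> Pow A. subset_weight A B)"
    using A by (subst measure_measure_pmf_finite) (auto intro!: sum.cong simp: pmf_bernoulli_subset)
  also have "\<dots> = (\<Sum>B\<in>Pow A. subset_weight A B * (\<Prod>S\<in>P. c S (B \<inter> \<phi> ` S)))"
    unfolding prod_c using A by (intro sum.mono_neutral_cong_left) auto
  also have "\<dots> = (\<Prod>S\<in>P. \<Sum>B\<in>Pow (\<phi> ` S). subset_weight (\<phi> ` S) B * c S B)" by (rule fact)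
  finally have D: "measure_pmf.prob ?\<mu> ?C = (\<Prod>S\<in>P. \<Sum>B\<in>Pow (\<phi> ` S). subset_weight (\<phi> ` S) B * c S B)" .
  have "(\<Sum>B\<in>Pow A. pmf (renyi_query_pmf p A \<phi> P) B *
      (\<Prod>T\<in>refine_partition \<phi> B P. height_cdf k (card T))) =
      (\<Sum>B\<in>Pow A. subset_weight A B * (\<Prod>S\<in>P. h S (B \<inter> \<phi> ` S)) / measure_pmf.prob ?\<mu> ?C)"
    unfolding prod_h[symmetric] renyi_query_pmf_def
    using sC A by (intro sum.cong refl) (auto simp: pmf_cond pmf_bernoulli_subset)
  also have "\<dots> = (\<Prod>S\<in>P. \<Sum>B\<in>Pow (\<phi> ` S). subset_weight (\<phi> ` S) B * h S B) /
      (\<Prod>S\<in>P. \<Sum>B\<in>Pow (\<phi> ` S). subset_weight (\<phi> ` S) B * c S B)"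
    unfolding sum_divide_distrib[symmetric] fact D ..
  also have "\<dots> = (\<Prod>S\<in>P. height_cdf (Suc k) (card S))"
    unfolding prod_dividef[symmetric]
  proof (intro prod.cong refl)
    fix S assume S: "S \<in> P"
    have f: "finite (\<phi> ` S)" using finS[OF S] by simp
    show "(\<Sum>B\<in>Pow (\<phi> ` S). subset_weight (\<phi> ` S) B * h S B) /
        (\<Sum>B\<in>Pow (\<phi> ` S). subset_weight (\<phi> ` S) B * c S B) = height_cdf (Suc k) (card S)"
    proof (cases "card S \<ge> 2")
      case True
      have "(\<Sum>B\<in>Pow (\<phi> ` S). subset_weight (\<phi> ` S) B * h S B) =
          (\<Sum>j\<in>{0<..<card S}. bin_weight (card S) j * (height_cdf k j * height_cdf k (card S - j)))"
        using sum_split_by_card[OF f, of "\<lambda>j. height_cdf k j * height_cdf k (card S - j)"] True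
        by (simp add: h_def cardS[OF S])
      moreover have "(\<Sum>B\<in>Pow (\<phi> ` S). subset_weight (\<phi> ` S) B * c S B) = split_norm (card S)"
        using sum_split_by_card[OF f, of "\<lambda>j. 1"] True sum_bin_weight[of "card S"]
        by (simp add: c_def cardS[OF S])
      ultimately show ?thesis using True by (simp add: height_cdf_Suc)
    next
      case False
      have "(\<Sum>B\<in>Pow (\<phi> ` S). subset_weight (\<phi> ` S) B) = 1"
        using sum_subset_weight_by_card[OF f, of "\<lambda>_. 1"] by (simp add: sum_bin_weight_atMost)
      thus ?thesis using False by (simp add: h_def c_def)
    qed
  qed
  finally show ?thesis .
qed

end

section \<open>Height and resolved partitions\<close>

lemma Union_renyi_partition: "\<Union>(renyi_partition X \<phi> q k) = X"
proof (induction k)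
  case (Suc k)
  have "\<Union>(refine_partition \<phi> B P) = \<Union>P" for B :: "'b set" and P :: "'a set set"
  proof -
    have "\<Union>(if card S \<ge> 2 then {S \<inter> \<phi> -` B, S - \<phi> -` B} else {S}) = S" for S
      by auto
    moreover have "\<Union>(\<Union>S\<in>P. R S) = (\<Union>S\<in>P. \<Union>(R S))" for R :: "'a set \<Rightarrow> 'a set set" by blast
    ultimately show ?thesis unfolding refine_partition_def by (simp only: image_ident)
  qed
  thus ?case using Suc by simp
qed simp

lemma singleton_class_persists:
  assumes "{x} \<in> renyi_partition X \<phi> q k" "k \<le> l"
  shows "{x} \<in> renyi_partition X \<phi> q l"
  using assms(2,1)
  by (induction l rule: dec_induct) (auto simp: refine_partition_def intro!: bexI[of _ "{x}"])

definition resolved :: "'a set set \<Rightarrow> bool" where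
  "resolved P \<longleftrightarrow> (\<forall>S\<in>P. card S \<le> 1)"

lemma resolved_singleton:
  assumes "finite X" "resolved (renyi_partition X \<phi> q k)" "x \<in> X"
  shows "{x} \<in> renyi_partition X \<phi> q k"
proof -
  obtain S where S: "S \<in> renyi_partition X \<phi> q k" "x \<in> S"
    using assms(3) Union_renyi_partition[of X \<phi> q k] by blast
  have "S \<subseteq> X" using S(1) Union_renyi_partition[of X \<phi> q k] by blast
  hence "finite S" using assms(1) by (rule finite_subset)
  moreover have "card S \<le> Suc 0" using assms(2) S(1) unfolding resolved_def by simp
  ultimately have "\<forall>y\<in>S. \<forall>z\<in>S. y = z" using card_le_Suc0_iff_eq[of S] by simp
  hence "S = {x}" using S(2) by blast
  thus ?thesis using S by simp
qed

text \<open>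
  The maximum in the definition of the height is meaningful only if every object is revealed
  eventually, which the premise \<open>res\<close> guarantees. Then the last reveal happens at the
  first level at which all classes are singletons.
\<close>

lemma renyi_height_le_iff_resolved:
  assumes X: "finite X" "X \<noteq> {}" and res: "resolved (renyi_partition X \<phi> q N)"
  shows "renyi_height X \<phi> q \<le> K \<longleftrightarrow> resolved (renyi_partition X \<phi> q K)"
proof -
  let ?P = "renyi_partition X \<phi> q"
  define E where "E = {k. external_profile X \<phi> q k > 0}"
  have pos: "k \<in> E \<longleftrightarrow> (\<exists>x\<in>X. {x} \<in> ?P k \<and> (k = 0 \<or> {x} \<notin> ?P (k - 1)))" for k
    unfolding E_def external_profile_def mem_Collect_eq using X(1) by (subst card_gt_0_iff) auto
  have upper: "k \<le> L" if rL: "resolved (?P L)" and kE: "k \<in> E" for k L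
  proof (rule ccontr)
    assume "\<not> k \<le> L"
    hence L: "L \<le> k - 1" "k \<noteq> 0" by auto
    obtain x where x: "x \<in> X" "{x} \<notin> ?P (k - 1)" using kE L unfolding pos by blast
    show False using singleton_class_persists[OF resolved_singleton[OF X(1) rL x(1)] L(1)] x(2) by simp
  qed
  have "E \<subseteq> {..N}" using upper[OF res] by blast
  hence fin: "finite E" using finite_subset by blast
  have reveal: "\<exists>k\<in>E. {x} \<in> ?P k" if "x \<in> X" for x
  proof -
    define k where "k = (LEAST k. {x} \<in> ?P k)"
    have k: "{x} \<in> ?P k" unfolding k_def using resolved_singleton[OF X(1) res that] by (rule LeastI)
    have "{x} \<notin> ?P (k - 1)" if "k \<noteq> 0"
      using not_less_Least[of "k - 1" "\<lambda>k. {x} \<in> ?P k"] that unfolding k_def[symmetric] by simp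
    hence "k = 0 \<or> {x} \<notin> ?P (k - 1)" by blast
    hence "k \<in> E" unfolding pos using k that by blast
    thus ?thesis using k by blast
  qed
  hence ne: "E \<noteq> {}" using X by blast
  have "renyi_height X \<phi> q = Max E" by (simp add: renyi_height_def E_def)
  moreover have "Max E \<le> K \<longleftrightarrow> (\<forall>k\<in>E. k \<le> K)" using fin ne by simp
  moreover have "(\<forall>k\<in>E. k \<le> K) \<longleftrightarrow> resolved (?P K)"
  proof
    assume le: "\<forall>k\<in>E. k \<le> K"
    show "resolved (?P K)" unfolding resolved_def
    proof
      fix S assume S: "S \<in> ?P K"
      show "card S \<le> 1"
      proof (cases "S = {}")
        case False
        then obtain x where x: "x \<in> S" by blast
        hence "x \<in> X" using S Union_renyi_partition[of X \<phi> q K] by blast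
        then obtain k where k: "k \<in> E" "{x} \<in> ?P k" using reveal by blast
        have "{x} \<in> ?P K" by (rule singleton_class_persists[OF k(2)]) (use le k(1) in blast)
        moreover have "S \<inter> {x} \<noteq> {}" using x by blast
        moreover have "\<forall>S\<in>?P K. \<forall>T\<in>?P K. S \<inter> T \<noteq> {} \<longrightarrow> S = T"
          using renyi_partition_disjoint[of X \<phi> q K] by (elim conjE)
        ultimately have "S = {x}" using S by simp
        thus ?thesis by simp
      qed simp
    qed
  next
    assume "resolved (?P K)"
    thus "\<forall>k\<in>E. k \<le> K" using upper by blast
  qed
  ultimately show ?thesis by (simp only:)
qed

section \<open>The law of the height\<close>

context bias
begin

lemma prod_height_cdf_0:
  assumes "finite P"
  shows "(\<Prod>S\<in>P. height_cdf 0 (card S)) = (if resolved P then 1 else 0)"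
  unfolding resolved_def using assms by (auto intro!: prod.neutral)

context
  fixes X :: "'a set" and A :: "'b set" and \<phi> :: "'a \<Rightarrow> 'b" and M :: "'w measure" and Q :: "nat \<Rightarrow> 'w \<Rightarrow> 'b set"
  assumes X: "finite X" and A: "finite A" and bij: "bij_betw \<phi> X A"
    and process: "renyi_process p X A \<phi> M Q"
begin

interpretation prob_space M
  using process by (simp add: renyi_process_def)

lemma query_range: "j \<ge> 1 \<Longrightarrow> \<omega> \<in> space M \<Longrightarrow> Q j \<omega> \<in> Pow A"
  using process measurable_space[of "Q j" M "count_space (Pow A)"] by (auto simp: renyi_process_def)

definition prefix_event :: "nat \<Rightarrow> (nat \<Rightarrow> 'b set) \<Rightarrow> 'w set" where
  "prefix_event k r = {\<omega>\<in>space M. \<forall>i\<in>{1..k}. Q i \<omega> = r i}"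

lemma prefix_event_sets:
  "prefix_event k r \<in> sets M"
proof -
  have "{\<omega>\<in>space M. Q i \<omega> = B} \<in> sets M" if "i \<ge> 1" for i B
  proof (cases "B \<subseteq> A")
    case True
    have "Q i -` {B} \<inter> space M \<in> sets M"
      using process that True
      by (intro measurable_sets[of _ M "count_space (Pow A)"]) (auto simp: renyi_process_def)
    thus ?thesis by (simp add: vimage_def Collect_conj_eq Int_commute)
  next
    case False
    hence "{\<omega>\<in>space M. Q i \<omega> = B} = {}" using query_range[OF that] by auto
    thus ?thesis by (simp only: sets.empty_sets)
  qed
  thus ?thesis unfolding prefix_event_def
    by (intro sets.sets_Collect_finite_All) auto
qed

lemma prob_prefix_event_Suc:
  "prob (prefix_event (Suc k) r) =
     prob (prefix_event k r) * pmf (renyi_query_pmf p A \<phi> (renyi_partition X \<phi> r k)) (r (Suc k))"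
  using process unfolding renyi_process_def prefix_event_def by blast

definition histories :: "nat \<Rightarrow> (nat \<Rightarrow> 'b set) set" where
  "histories k = PiE {1..k} (\<lambda>_. Pow A)"

lemma finite_histories: "finite (histories k)"
  unfolding histories_def using A by (intro finite_PiE) auto

lemma prefix_event_cong: "(\<And>i. 1 \<le> i \<Longrightarrow> i \<le> k \<Longrightarrow> r i = r' i) \<Longrightarrow> prefix_event k r = prefix_event k r'"
  by (auto simp: prefix_event_def)

lemma sum_histories_Suc:
  fixes F :: "(nat \<Rightarrow> 'b set) \<Rightarrow> real"
  shows "(\<Sum>r\<in>histories (Suc k). F r) = (\<Sum>r\<in>histories k. \<Sum>B\<in>Pow A. F (r(Suc k := B)))"
proof -
  have ins: "{1..Suc k} = insert (Suc k) {1..k}" by auto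
  have "(\<Sum>r\<in>histories (Suc k). F r) = (\<Sum>x\<in>Pow A \<times> histories k. F ((\<lambda>(B, r). r(Suc k := B)) x))"
    unfolding histories_def ins PiE_insert_eq
    by (subst sum.reindex) (auto intro!: inj_combinator simp: o_def)
  also have "\<dots> = (\<Sum>B\<in>Pow A. \<Sum>r\<in>histories k. F (r(Suc k := B)))"
    by (simp add: sum.cartesian_product case_prod_unfold)
  also have "\<dots> = (\<Sum>r\<in>histories k. \<Sum>B\<in>Pow A. F (r(Suc k := B)))" by (rule sum.swap)
  finally show ?thesis .
qed

text \<open>
  The process is specified by the probabilities of its finite histories, so expectations over the
  first \<open>k\<close> queries are finite sums over \<open>histories k\<close>. Conditioning on the first \<open>k\<close> queries
  replaces query \<open>k + 1\<close> by one more step of the recursion for every class.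
\<close>

lemma history_expectation_step:
  "(\<Sum>r\<in>histories (Suc k). prob (prefix_event (Suc k) r) *
      (\<Prod>S\<in>renyi_partition X \<phi> r (Suc k). height_cdf l (card S))) =
   (\<Sum>r\<in>histories k. prob (prefix_event k r) *
      (\<Prod>S\<in>renyi_partition X \<phi> r k. height_cdf (Suc l) (card S)))"
  unfolding sum_histories_Suc
proof (intro sum.cong refl)
  fix r assume "r \<in> histories k"
  have cong: "renyi_partition X \<phi> (r(Suc k := B)) k = renyi_partition X \<phi> r k"
    "prefix_event k (r(Suc k := B)) = prefix_event k r" for B
    by (auto intro!: renyi_partition_cong prefix_event_cong)
  note part = renyi_partition_disjoint[of X \<phi> r k]
  have "(\<Sum>B\<in>Pow A. prob (prefix_event (Suc k) (r(Suc k := B))) *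
      (\<Prod>S\<in>renyi_partition X \<phi> (r(Suc k := B)) (Suc k). height_cdf l (card S))) =
      prob (prefix_event k r) * (\<Sum>B\<in>Pow A. pmf (renyi_query_pmf p A \<phi> (renyi_partition X \<phi> r k)) B *
      (\<Prod>S\<in>refine_partition \<phi> B (renyi_partition X \<phi> r k). height_cdf l (card S)))"
    by (simp add: prob_prefix_event_Suc cong sum_distrib_left mult.assoc)
  also have "(\<Sum>B\<in>Pow A. pmf (renyi_query_pmf p A \<phi> (renyi_partition X \<phi> r k)) B *
      (\<Prod>S\<in>refine_partition \<phi> B (renyi_partition X \<phi> r k). height_cdf l (card S))) =
      (\<Prod>S\<in>renyi_partition X \<phi> r k. height_cdf (Suc l) (card S))"
    using part ex_conclusive_query[OF bij, of r k] by (intro renyi_query_step[OF X A bij]) auto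
  finally show "(\<Sum>B\<in>Pow A. prob (prefix_event (Suc k) (r(Suc k := B))) *
      (\<Prod>S\<in>renyi_partition X \<phi> (r(Suc k := B)) (Suc k). height_cdf l (card S))) =
      prob (prefix_event k r) * (\<Prod>S\<in>renyi_partition X \<phi> r k. height_cdf (Suc l) (card S))" .
qed

lemma history_expectation:
  "(\<Sum>r\<in>histories k. prob (prefix_event k r) *
      (\<Prod>S\<in>renyi_partition X \<phi> r k. height_cdf l (card S))) = height_cdf (k + l) (card X)"
proof (induction k arbitrary: l)
  case 0
  show ?case by (simp add: histories_def prefix_event_def prob_space)
next
  case (Suc k)
  show ?case unfolding history_expectation_step Suc.IH by simp
qed

definition resolved_event :: "nat \<Rightarrow> 'w set" where
  "resolved_event k = {\<omega>\<in>space M. resolved (renyi_partition X \<phi> (\<lambda>j. Q j \<omega>) k)}"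

lemma resolved_event_eq:
  "resolved_event k = (\<Union>r\<in>{r\<in>histories k. resolved (renyi_partition X \<phi> r k)}. prefix_event k r)"
proof (intro equalityI subsetI)
  fix \<omega> assume \<omega>: "\<omega> \<in> resolved_event k"
  define r where "r = restrict (\<lambda>j. Q j \<omega>) {1..k}"
  have "renyi_partition X \<phi> r k = renyi_partition X \<phi> (\<lambda>j. Q j \<omega>) k"
    by (intro renyi_partition_cong) (auto simp: r_def)
  hence "r \<in> {r\<in>histories k. resolved (renyi_partition X \<phi> r k)}" "\<omega> \<in> prefix_event k r"
    using \<omega> query_range unfolding resolved_event_def prefix_event_def histories_def
    by (auto simp: r_def)
  thus "\<omega> \<in> (\<Union>r\<in>{r\<in>histories k. resolved (renyi_partition X \<phi> r k)}. prefix_event k r)" by blast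
next
  fix \<omega> assume "\<omega> \<in> (\<Union>r\<in>{r\<in>histories k. resolved (renyi_partition X \<phi> r k)}. prefix_event k r)"
  then obtain r where r: "resolved (renyi_partition X \<phi> r k)" "\<omega> \<in> prefix_event k r" by blast
  have "renyi_partition X \<phi> r k = renyi_partition X \<phi> (\<lambda>j. Q j \<omega>) k"
    using r(2) by (intro renyi_partition_cong) (auto simp: prefix_event_def)
  thus "\<omega> \<in> resolved_event k" using r by (simp add: resolved_event_def prefix_event_def)
qed

lemma resolved_event_sets: "resolved_event k \<in> sets M"
  unfolding resolved_event_eq using finite_histories prefix_event_sets by (intro sets.finite_UN) auto

lemma prob_resolved_event: "prob (resolved_event k) = height_cdf k (card X)"
proof -
  have "disjoint_family_on (prefix_event k) (histories k)"
    unfolding disjoint_family_on_def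
  proof (intro ballI impI, rule ccontr)
    fix r r' assume r: "r \<in> histories k" "r' \<in> histories k" "r \<noteq> r'"
      and "prefix_event k r \<inter> prefix_event k r' \<noteq> {}"
    hence "\<forall>i\<in>{1..k}. r i = r' i" by (auto simp: prefix_event_def)
    hence "r = r'" using r by (intro PiE_ext[of _ "{1..k}" "\<lambda>_. Pow A"]) (auto simp: histories_def)
    thus False using r by simp
  qed
  hence "prob (resolved_event k) = (\<Sum>r\<in>{r\<in>histories k. resolved (renyi_partition X \<phi> r k)}. prob (prefix_event k r))"
    unfolding resolved_event_eq using finite_histories prefix_event_sets
    by (intro finite_measure_finite_Union) (auto simp: disjoint_family_on_def)
  also have "\<dots> = (\<Sum>r\<in>histories k. prob (prefix_event k r) *
      (\<Prod>S\<in>renyi_partition X \<phi> r k. height_cdf 0 (card S)))"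
    using finite_histories renyi_partition_disjoint[of X \<phi>]
    by (subst sum.inter_filter) (auto intro!: sum.cong simp: prod_height_cdf_0 simp del: height_cdf.simps)
  also have "\<dots> = height_cdf k (card X)" using history_expectation[of k 0] by simp
  finally show ?thesis .
qed

text \<open>
  Termination of the process, read off from \<open>height_cdf n n = 1\<close>.
\<close>

lemma AE_eventually_resolved: "AE \<omega> in M. \<omega> \<in> resolved_event (card X)"
  using resolved_event_sets prob_resolved_event[of "card X"] height_cdf_eq_1[of "card X" "card X"]
  by (subst prob_eq_1[symmetric]) auto

text \<open>
  The sum over histories at level \<open>k\<close>, evaluated with no queries left, is the probability that all
  classes are singletons; evaluated before the first query it is \<open>height_cdf k (card X)\<close>.
\<close>

theorem prob_height_le:
  assumes "X \<noteq> {}"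
  shows "\<P>(\<omega> in M. renyi_height X \<phi> (\<lambda>j. Q j \<omega>) \<le> k) = height_cdf k (card X)"
proof -
  have [measurable]: "(\<lambda>\<omega>. renyi_height X \<phi> (\<lambda>j. Q j \<omega>)) \<in> M \<rightarrow>\<^sub>M count_space UNIV"
    by (rule measurable_renyi_height[OF process A X])
  have "\<P>(\<omega> in M. renyi_height X \<phi> (\<lambda>j. Q j \<omega>) \<le> k) = prob (resolved_event k)"
  proof (rule finite_measure_eq_AE)
    show "AE \<omega> in M. (\<omega> \<in> {\<omega> \<in> space M. renyi_height X \<phi> (\<lambda>j. Q j \<omega>) \<le> k}) = (\<omega> \<in> resolved_event k)"
      using AE_eventually_resolved
    proof eventually_elim
      case (elim \<omega>)
      thus ?case using renyi_height_le_iff_resolved[OF X assms, of \<phi> "\<lambda>j. Q j \<omega>" "card X" k]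
        by (auto simp: resolved_event_def)
    qed
  qed (use resolved_event_sets in measurable)
  thus ?thesis using prob_resolved_event by simp
qed

end


section \<open>Upper tail of the height\<close>

text \<open>
  Each of the \<open>m choose s\<close> sets of \<open>s\<close> objects is included as a whole with probability \<open>p ^ s\<close>.
\<close>

lemma sum_bin_weight_choose:
  "(\<Sum>j\<le>m. bin_weight m j * real (j choose s)) = p ^ s * real (m choose s)"
proof (cases "s \<le> m")
  case True
  have "(\<Sum>j\<le>m. bin_weight m j * real (j choose s)) = (\<Sum>j\<in>{s..m}. bin_weight m j * real (j choose s))"
    by (intro sum.mono_neutral_right) auto
  also have "\<dots> = (\<Sum>i\<le>m - s. bin_weight m (i + s) * real ((i + s) choose s))"
    by (rule sum.reindex_bij_witness[of _ "\<lambda>i. i + s" "\<lambda>j. j - s"]) (use True in auto)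
  also have "\<dots> = (\<Sum>i\<le>m - s. p ^ s * real (m choose s) * bin_weight (m - s) i)"
  proof (intro sum.cong refl)
    fix i assume i: "i \<in> {..m - s}"
    have "(m choose (i + s)) * ((i + s) choose s) = (m choose s) * ((m - s) choose i)"
      using choose_mult[of s "i + s" m] i True by simp
    hence "real (m choose (i + s)) * real ((i + s) choose s) = real (m choose s) * real ((m - s) choose i)"
      by (metis of_nat_mult)
    thus "bin_weight m (i + s) * real ((i + s) choose s) = p ^ s * real (m choose s) * bin_weight (m - s) i"
      by (simp add: bin_weight_def power_add algebra_simps)
  qed
  also have "\<dots> = p ^ s * real (m choose s)"
    by (simp add: sum_distrib_left[symmetric] sum_bin_weight_atMost)
  finally show ?thesis .
next
  case False
  hence "(\<Sum>j\<le>m. bin_weight m j * real (j choose s)) = 0"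
    by (intro sum.neutral) auto
  thus ?thesis using False by simp
qed

lemma bias_swap: "bias q p"
  using p_pos q_pos p_plus_q by unfold_locales auto

lemma bin_weight_swap: "j \<le> m \<Longrightarrow> bias.bin_weight q p m j = bin_weight m (m - j)"
  unfolding bin_weight_def bias.bin_weight_def[OF bias_swap]
  by (simp add: binomial_symmetric[of j m])

lemma sum_bin_weight_choose':
  "(\<Sum>j\<le>m. bin_weight m j * real ((m - j) choose s)) = q ^ s * real (m choose s)"
proof -
  have "(\<Sum>j\<le>m. bin_weight m j * real ((m - j) choose s)) =
      (\<Sum>j\<le>m. bin_weight m (m - j) * real (j choose s))"
    by (rule sum.reindex_bij_witness[of _ "\<lambda>j. m - j" "\<lambda>j. m - j"]) auto
  also have "\<dots> = (\<Sum>j\<le>m. bias.bin_weight q p m j * real (j choose s))"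
    by (intro sum.cong) (auto simp: bin_weight_swap)
  finally show ?thesis using bias.sum_bin_weight_choose[OF bias_swap] by simp
qed

text \<open>
  Without conditioning the mean of the left-hand side would be exactly
  \<open>(p ^ s + q ^ s) * (m choose s)\<close>. The trivial splits, which the conditioning removes, are those
  where the moment is not reduced at all, so removing them can only lower the mean.
\<close>

lemma split_choose_contraction:
  assumes "m \<ge> 2" "s \<ge> 1"
  shows "(\<Sum>j\<in>{0<..<m}. bin_weight m j * (real (j choose s) + real ((m - j) choose s))) / split_norm m
    \<le> (p ^ s + q ^ s) * real (m choose s)"
proof (cases "s \<le> m")
  case True
  have m: "m \<ge> 1" using assms by simp
  have [simp]: "0 choose s = 0" using assms(2) by (cases s) auto
  have "(\<Sum>j\<le>m. bin_weight m j * (real (j choose s) + real ((m - j) choose s))) = (p ^ s + q ^ s) * real (m choose s)"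
    by (simp add: distrib_left sum.distrib sum_bin_weight_choose sum_bin_weight_choose' distrib_right)
  hence eq: "(\<Sum>j\<in>{0<..<m}. bin_weight m j * (real (j choose s) + real ((m - j) choose s))) =
      (p ^ s + q ^ s - (p ^ m + q ^ m)) * real (m choose s)"
    using sum_atMost_split_ends[OF m, of "\<lambda>j. bin_weight m j * (real (j choose s) + real ((m - j) choose s))"] assms(2)
    by (simp add: bin_weight_def algebra_simps)
  have "p ^ s \<le> p" "q ^ s \<le> q"
    using power_decreasing[of 1 s p] power_decreasing[of 1 s q] assms p_pos q_pos p_less_1 q_less_1 by auto
  hence le: "p ^ s + q ^ s \<le> 1" using p_plus_q by linarith
  have "(p ^ m + q ^ m) * (p ^ s + q ^ s) \<le> (p ^ m + q ^ m) * 1"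
    using le p_pos q_pos by (intro mult_left_mono) auto
  hence "p ^ s + q ^ s - (p ^ m + q ^ m) \<le> (p ^ s + q ^ s) * split_norm m"
    by (simp add: split_norm_def algebra_simps)
  hence "(p ^ s + q ^ s - (p ^ m + q ^ m)) * real (m choose s) \<le> (p ^ s + q ^ s) * split_norm m * real (m choose s)"
    by (intro mult_right_mono) auto
  thus ?thesis unfolding eq using split_norm_pos[OF assms(1)]
    by (simp add: field_simps)
next
  case False
  hence "(\<Sum>j\<in>{0<..<m}. bin_weight m j * (real (j choose s) + real ((m - j) choose s))) = 0"
    by (intro sum.neutral) (auto simp: binomial_eq_0)
  thus ?thesis using p_pos q_pos by simp
qed

text \<open>
  A class is unresolved only if one of its two parts is: a union bound turns the product in the
  recursion into the sum to which the moment contraction applies.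
\<close>

lemma exceedance_step:
  assumes bound: "\<And>m. 1 - height_cdf k m \<le> c * real (m choose s)" and s: "s \<ge> 1" and c: "c \<ge> 0"
  shows "1 - height_cdf (Suc k) m \<le> c * (p ^ s + q ^ s) * real (m choose s)"
proof (cases "m \<ge> 2")
  case True
  have "1 - height_cdf (Suc k) m \<le>
      (\<Sum>j\<in>{0<..<m}. c * (bin_weight m j * (real (j choose s) + real ((m - j) choose s)))) / split_norm m"
    unfolding one_minus_height_cdf_Suc[OF True]
  proof (intro divide_right_mono sum_mono)
    fix j
    have "(1 - height_cdf k j) * (1 - height_cdf k (m - j)) \<ge> 0"
      using height_cdf_le_1 by simp
    hence "1 - height_cdf k j * height_cdf k (m - j) \<le> (1 - height_cdf k j) + (1 - height_cdf k (m - j))"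
      by (simp add: algebra_simps)
    also have "\<dots> \<le> c * (real (j choose s) + real ((m - j) choose s))"
      using bound[of j] bound[of "m - j"] by (simp add: algebra_simps)
    finally show "bin_weight m j * (1 - height_cdf k j * height_cdf k (m - j))
        \<le> c * (bin_weight m j * (real (j choose s) + real ((m - j) choose s)))"
      using bin_weight_nonneg[of m j] by (metis mult.left_commute mult_left_mono)
  qed (use split_norm_pos[OF True] in auto)
  also have "\<dots> \<le> c * ((p ^ s + q ^ s) * real (m choose s))"
    using mult_left_mono[OF split_choose_contraction[OF True s] c]
    by (simp add: sum_distrib_left)
  finally show ?thesis by simp
next
  case False
  hence "height_cdf (Suc k) m = 1" by simp
  thus ?thesis using c p_pos q_pos by simp
qed

text \<open>
  The product of the contraction factors for the moments of order \<open>2, ..., y + 1\<close>.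
\<close>

definition descent_const :: "nat \<Rightarrow> real" where
  "descent_const y = (\<Prod>i<y. p ^ (i + 2) + q ^ (i + 2))"

text \<open>
  One more query contracts the moment of order \<open>y + 2\<close>, which may then be replaced by the moment of
  order \<open>y + 3\<close>: the falling factorial of \<open>m\<close> (binomial coefficient times \<open>fact\<close>) grows with its order
  as long as \<open>m \<ge> y + 3\<close>, and for smaller \<open>m\<close> the class is resolved with certainty.
\<close>

lemma exceedance_descent:
  "1 - height_cdf y m \<le> descent_const y * fact (y + 2) * real (m choose (y + 2))"
proof (induction y arbitrary: m)
  case 0
  show ?case
  proof (cases "m \<ge> 2")
    case True
    hence "1 \<le> 2 * real (m choose Suc (Suc 0))"
      using zero_less_binomial[of "Suc (Suc 0)" m] by linarith
    thus ?thesis using True by (simp add: descent_const_def)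
  qed (simp add: descent_const_def)
next
  case (Suc y)
  let ?s = "y + 2"
  have nn: "descent_const y \<ge> 0" using p_pos q_pos by (simp add: descent_const_def prod_nonneg)
  have step: "1 - height_cdf (Suc y) m \<le> descent_const y * fact ?s * (p ^ ?s + q ^ ?s) * real (m choose ?s)"
    by (rule exceedance_step[OF Suc]) (use nn in auto)
  show ?case
  proof (cases "m \<ge> Suc ?s")
    case True
    have "Suc ?s * (m choose Suc ?s) = (m - ?s) * (m choose ?s)"
      using True by (metis add.commute binomial_absorb_comp binomial_absorption)
    also have "\<dots> \<ge> 1 * (m choose ?s)" using True by (intro mult_right_mono) auto
    finally have "real (m choose ?s) \<le> real (Suc ?s) * real (m choose Suc ?s)"
      by (metis mult_1 of_nat_le_iff of_nat_mult)
    hence "descent_const y * fact ?s * (p ^ ?s + q ^ ?s) * real (m choose ?s) \<le>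
        descent_const y * fact ?s * (p ^ ?s + q ^ ?s) * (real (Suc ?s) * real (m choose Suc ?s))"
      using nn p_pos q_pos by (intro mult_left_mono mult_nonneg_nonneg) auto
    also have "\<dots> = descent_const (Suc y) * fact (Suc y + 2) * real (m choose (Suc y + 2))"
      by (simp add: descent_const_def algebra_simps)
    finally show ?thesis using step by linarith
  next
    case False
    hence "height_cdf (Suc y) m = 1" by (intro height_cdf_eq_1) auto
    thus ?thesis using nn p_pos q_pos by (simp add: descent_const_def prod_nonneg)
  qed
qed

lemma exceedance_bound_choose:
  "1 - height_cdf (k + y) m \<le>
     descent_const y * fact (y + 2) * (p ^ (y + 2) + q ^ (y + 2)) ^ k * real (m choose (y + 2))"
proof (induction k arbitrary: m)
  case 0 thus ?case using exceedance_descent by simp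
next
  case (Suc k)
  show ?case
    using exceedance_step[OF Suc, of m] p_pos q_pos
    by (simp add: descent_const_def prod_nonneg mult_ac)
qed

theorem exceedance_bound:
  "1 - height_cdf (k + y) m \<le>
     descent_const y * (p ^ (y + 2) + q ^ (y + 2)) ^ k * real m ^ (y + 2)"
proof -
  have "real ((m choose (y + 2)) * fact (y + 2)) \<le> real (m ^ (y + 2))"
    using binomial_fact_pow[of m "y + 2"] of_nat_le_iff by blast
  hence "fact (y + 2) * real (m choose (y + 2)) \<le> real m ^ (y + 2)"
    unfolding of_nat_mult of_nat_fact of_nat_power by (subst mult.commute)
  hence "descent_const y * (p ^ (y + 2) + q ^ (y + 2)) ^ k * (fact (y + 2) * real (m choose (y + 2)))
      \<le> descent_const y * (p ^ (y + 2) + q ^ (y + 2)) ^ k * real m ^ (y + 2)"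
    using p_pos q_pos
    by (intro mult_left_mono mult_nonneg_nonneg) (auto simp: descent_const_def intro!: prod_nonneg)
  thus ?thesis using exceedance_bound_choose[of k y m] by (simp add: mult_ac)
qed

section \<open>A tall subtree with explicit probability\<close>

lemma choose_le_choose_Suc: "(n choose r) \<le> (Suc n choose r)"
  by (cases r) auto

lemma choose_le_choose_add: "(n choose r) \<le> ((n + s) choose (r + s))"
proof (induction s)
  case (Suc s) thus ?case by simp
qed auto

text \<open>
  The right-hand side is the probability that the first \<open>s\<close> of \<open>m\<close> objects are included and the
  last one is not, which forces the number \<open>j\<close> of included objects into the range of the sum.
\<close>

lemma descent_probability:
  assumes "s \<ge> 1" "s < m"
  shows "(\<Sum>j\<in>{s..<m}. bin_weight m j) \<ge> p ^ s * q"
proof -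
  let ?r = "m - 1 - s"
  have "p ^ s * q = (\<Sum>i\<le>?r. p ^ s * q * bin_weight ?r i)"
    by (simp add: sum_distrib_left[symmetric] sum_bin_weight_atMost)
  also have "\<dots> \<le> (\<Sum>i\<le>?r. bin_weight m (i + s))"
  proof (intro sum_mono)
    fix i assume i: "i \<in> {..?r}"
    have "(?r choose i) \<le> ((m - 1) choose (i + s))"
      using choose_le_choose_add[of ?r i s] assms by simp
    also have "\<dots> \<le> (m choose (i + s))" using choose_le_choose_Suc[of "m - 1" "i + s"] assms(2) by (simp only: Suc_diff_1)
    finally have le: "real (?r choose i) \<le> real (m choose (i + s))" by simp
    have "p ^ s * q * bin_weight ?r i = real (?r choose i) * (p ^ s * q * (p ^ i * q ^ (?r - i)))"
      by (simp add: bin_weight_def)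
    also have "p ^ s * q * (p ^ i * q ^ (?r - i)) = p ^ (i + s) * q ^ (m - (i + s))"
    proof -
      have "m - (i + s) = Suc (?r - i)" using i assms by auto
      thus ?thesis by (simp add: power_add)
    qed
    also have "real (?r choose i) * \<dots> \<le> real (m choose (i + s)) * \<dots>"
      using le p_pos q_pos by (intro mult_right_mono) auto
    also have "\<dots> = bin_weight m (i + s)" by (simp add: bin_weight_def)
    finally show "p ^ s * q * bin_weight ?r i \<le> bin_weight m (i + s)" .
  qed
  also have "\<dots> = (\<Sum>j\<in>{s..<m}. bin_weight m j)"
    by (rule sum.reindex_bij_witness[of _ "\<lambda>j. j - s" "\<lambda>i. i + s"]) (use assms in auto)
  finally show ?thesis .
qed

text \<open>
  The probability bound for shrinking by as little as possible in each of \<open>y\<close> queries.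
\<close>

definition tall_prob :: "nat \<Rightarrow> real" where
  "tall_prob y = (\<Prod>i<y. p ^ (i + 2) * q)"

lemma tall_prob_pos: "tall_prob y > 0"
  unfolding tall_prob_def using p_pos q_pos by (intro prod_pos) auto

lemma tall_prob_le_1: "tall_prob y \<le> 1"
  unfolding tall_prob_def using p_pos q_pos p_less_1 q_less_1
  by (intro prod_le_1) (auto intro!: mult_le_one power_le_one)

text \<open>
  It suffices that the successive queries keep at least \<open>y + 1, y, ..., 2\<close> objects on the included
  side. Asking for at least, not exactly, that many makes the bound uniform in \<open>m\<close>, so larger
  classes are covered by the same induction.
\<close>

lemma height_cdf_le_tall_prob:
  assumes "m \<ge> y + 2"
  shows "height_cdf y m \<le> 1 - tall_prob y"
  using assms
proof (induction y arbitrary: m)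
  case 0 thus ?case by (simp add: tall_prob_def)
next
  case (Suc y)
  have m: "m \<ge> 2" using Suc.prems by simp
  have "p ^ (y + 2) * q * tall_prob y \<le> (\<Sum>j\<in>{y + 2..<m}. bin_weight m j) * tall_prob y"
    using descent_probability[of "y + 2" m] Suc.prems tall_prob_pos[of y] by (intro mult_right_mono) auto
  also have "\<dots> \<le> (\<Sum>j\<in>{y + 2..<m}. bin_weight m j * (1 - height_cdf y j * height_cdf y (m - j)))"
    unfolding sum_distrib_right
  proof (intro sum_mono mult_left_mono bin_weight_nonneg)
    fix j assume "j \<in> {y + 2..<m}"
    hence "height_cdf y j \<le> 1 - tall_prob y" using Suc.IH by simp
    moreover have "height_cdf y j * height_cdf y (m - j) \<le> height_cdf y j"
      using height_cdf_bounds by (simp add: mult_left_le)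
    ultimately show "tall_prob y \<le> 1 - height_cdf y j * height_cdf y (m - j)" by linarith
  qed
  also have "\<dots> \<le> (\<Sum>j\<in>{0<..<m}. bin_weight m j * (1 - height_cdf y j * height_cdf y (m - j)))"
    using height_cdf_bounds bin_weight_nonneg
    by (intro sum_mono2) (auto intro!: mult_nonneg_nonneg mult_le_one)
  also have "\<dots> \<le> \<dots> / split_norm m"
    using split_norm_pos[OF m] split_norm_le_1 height_cdf_bounds bin_weight_nonneg
    by (subst pos_le_divide_eq, simp, intro mult_left_le sum_nonneg mult_nonneg_nonneg)
       (auto intro!: mult_le_one)
  also have "\<dots> = 1 - height_cdf (Suc y) m" using one_minus_height_cdf_Suc[OF m] by simp
  finally show ?case by (simp add: tall_prob_def mult_ac)
qed

lemma bin_weight_eq_pmf: "bin_weight m j = pmf (binomial_pmf m p) j"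
  using p_pos p_less_1 by (simp add: bin_weight_def q_eq[symmetric])

lemma sum_bin_weight_deviation:
  assumes "m > 0" "\<eta> \<ge> 0" "J \<subseteq> {j. \<bar>real j - real m * p\<bar> \<ge> \<eta> * real m}" "finite J"
  shows "(\<Sum>j\<in>J. bin_weight m j) \<le> 2 * exp (-2 * \<eta>\<^sup>2 * real m)"
proof -
  interpret binomial_distribution m p
    using p_pos p_less_1 by unfold_locales auto
  have "(\<Sum>j\<in>J. bin_weight m j) = measure_pmf.prob (binomial_pmf m p) J"
    by (simp add: bin_weight_eq_pmf measure_measure_pmf_finite[OF assms(4)])
  also have "\<dots> \<le> measure_pmf.prob (binomial_pmf m p) {j. \<bar>real j - real m * p\<bar> \<ge> \<eta> * real m}"
    using assms by (intro measure_pmf.finite_measure_mono) auto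
  also have "\<dots> \<le> 2 * exp (-2 * (\<eta> * real m)\<^sup>2 / real m)"
    using assms by (intro prob_abs_ge) auto
  also have "-2 * (\<eta> * real m)\<^sup>2 / real m = -2 * \<eta>\<^sup>2 * real m"
    using assms by (simp add: power2_eq_square)
  finally show ?thesis .
qed


section \<open>Many classes of predictable size\<close>

text \<open>
  A class that still has to undergo \<open>i\<close> splits, among them \<open>j\<close> to the \<open>q\<close>-side, should have at least
  \<open>threshold c i j\<close> objects in order to produce a class of \<open>c\<close> objects at the end. The factor
  \<open>2 - sqrt p ^ i\<close> increases from 1 to less than 2 and so leaves room for relative deviations
  \<open>slack i\<close> in each split. These decay like \<open>sqrt p ^ i\<close>, which is just slow enough for
  \<open>(slack i)\<^sup>2 * threshold c i j\<close> to stay above a constant multiple of \<open>c\<close>, so one exponential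
  bound \<open>exp (- deviation_rate * c)\<close> serves for all splits.
\<close>

definition slack :: "nat \<Rightarrow> real" where
  "slack i = q * sqrt p ^ i * (1 - sqrt p) / 2"

definition threshold :: "real \<Rightarrow> nat \<Rightarrow> nat \<Rightarrow> real" where
  "threshold c i j = c * (2 - sqrt p ^ i) / (p ^ (i - j) * q ^ j)"

definition deviation_rate :: real where
  "deviation_rate = q\<^sup>2 * (1 - sqrt p)\<^sup>2 / (2 * p)"

lemma sqrt_p: "0 < sqrt p" "sqrt p < 1"
  using p_pos p_less_1 by auto

lemma sqrt_p_power: "0 < sqrt p ^ i" "sqrt p ^ i \<le> 1"
  using sqrt_p by (auto intro: power_le_one)

lemma slack_nonneg: "slack i \<ge> 0"
  using sqrt_p sqrt_p_power[of i] q_pos by (simp add: slack_def)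

lemma deviation_rate_pos: "deviation_rate > 0"
  using sqrt_p p_pos q_pos by (simp add: deviation_rate_def)

text \<open>
  The increase of the factor \<open>2 - sqrt p ^ i\<close> from \<open>i\<close> to \<open>i + 1\<close> pays for the relative loss
  \<open>slack i / x\<close>; the choice of \<^const>\<open>slack\<close> makes this exact for \<open>x = q\<close> when the factor is replaced
  by its bound 2.
\<close>

lemma threshold_factor:
  assumes "q \<le> x"
  shows "2 - sqrt p ^ i \<le> (2 - sqrt p ^ Suc i) * ((x - slack i) / x)"
proof -
  have x: "x > 0" using assms q_pos by linarith
  have "(2 - sqrt p ^ Suc i) * (slack i / x) \<le> 2 * (slack i / q)"
    using assms q_pos slack_nonneg[of i] sqrt_p_power[of "Suc i"] by (intro mult_mono divide_left_mono) auto
  also have "\<dots> = sqrt p ^ i - sqrt p ^ Suc i"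
  proof -
    have "2 * (slack i / q) = sqrt p ^ i * (1 - sqrt p)" using q_pos by (simp add: slack_def)
    thus ?thesis by (simp add: algebra_simps)
  qed
  finally have "(2 - sqrt p ^ Suc i) * (slack i / x) \<le> sqrt p ^ i - sqrt p ^ Suc i" .
  moreover have "(x - slack i) / x = 1 - slack i / x" using x by (simp add: diff_divide_distrib)
  hence "(2 - sqrt p ^ Suc i) * ((x - slack i) / x) = (2 - sqrt p ^ Suc i) - (2 - sqrt p ^ Suc i) * (slack i / x)"
    by (simp only: right_diff_distrib mult_1_right)
  ultimately show ?thesis by (simp only:)
qed

lemma slack_le_q: "slack i \<le> q"
proof -
  have "q * (sqrt p ^ i * (1 - sqrt p) / 2) \<le> q * 1"
    using sqrt_p sqrt_p_power[of i] q_pos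
    by (intro mult_left_mono) (auto intro: order_trans[OF mult_le_one])
  thus ?thesis by (simp add: slack_def mult_ac)
qed

lemma threshold_step_p:
  assumes "q \<le> p" "c \<ge> 0" "j \<le> i"
  shows "threshold c i j \<le> (p - slack i) * threshold c (Suc i) j"
proof -
  have e: "p ^ (Suc i - j) * q ^ j = p * (p ^ (i - j) * q ^ j)"
    using assms by (simp add: Suc_diff_le)
  have "threshold c i j \<le> c * ((2 - sqrt p ^ Suc i) * ((p - slack i) / p)) / (p ^ (i - j) * q ^ j)"
    unfolding threshold_def using threshold_factor[OF assms(1), of i] assms p_pos q_pos
    by (intro divide_right_mono mult_left_mono) auto
  also have "\<dots> = (p - slack i) * threshold c (Suc i) j"
    unfolding threshold_def e by (simp add: mult_ac)
  finally show ?thesis .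
qed

lemma threshold_step_q:
  assumes "c \<ge> 0"
  shows "threshold c i j \<le> (q - slack i) * threshold c (Suc i) (Suc j)"
proof -
  have "threshold c i j \<le> c * ((2 - sqrt p ^ Suc i) * ((q - slack i) / q)) / (p ^ (i - j) * q ^ j)"
    unfolding threshold_def using threshold_factor[OF order_refl, of i] assms p_pos q_pos
    by (intro divide_right_mono mult_left_mono) auto
  also have "\<dots> = (q - slack i) * threshold c (Suc i) (Suc j)"
    unfolding threshold_def by (simp add: mult_ac)
  finally show ?thesis .
qed

lemma threshold_ge:
  assumes "q \<le> p" "c \<ge> 0" "j \<le> i"
  shows "threshold c i j \<ge> c / p ^ i"
proof -
  have "p ^ (i - j) * q ^ j \<le> p ^ (i - j) * p ^ j"
    using assms p_pos q_pos by (intro mult_left_mono power_mono) auto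
  also have "\<dots> = p ^ i" using assms by (simp flip: power_add)
  finally have le: "p ^ (i - j) * q ^ j \<le> p ^ i" .
  have "c * 1 / p ^ i \<le> c * (2 - sqrt p ^ i) / (p ^ (i - j) * q ^ j)"
    using le assms p_pos q_pos sqrt_p_power[of i] by (intro frac_le mult_left_mono) auto
  thus ?thesis by (simp add: threshold_def)
qed

lemma threshold_le:
  assumes "c \<ge> 0"
  shows "threshold c i j \<le> 2 * c / (p ^ (i - j) * q ^ j)"
  unfolding threshold_def using assms p_pos q_pos sqrt_p_power[of i]
  by (intro divide_right_mono) (auto simp: mult.commute[of c] intro!: mult_right_mono)

lemma slack_deviation:
  assumes "c \<ge> 0" "real m \<ge> c / p ^ Suc i"
  shows "exp (-2 * (slack i)\<^sup>2 * real m) \<le> exp (- deviation_rate * c)"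
proof -
  have "(sqrt p ^ i)\<^sup>2 = (sqrt p ^ 2) ^ i" by (simp only: power_mult[symmetric] mult.commute)
  hence "(sqrt p ^ i)\<^sup>2 = p ^ i" using p_pos by simp
  hence sl: "(slack i)\<^sup>2 = q\<^sup>2 * p ^ i * (1 - sqrt p)\<^sup>2 / 4"
    by (simp add: slack_def power_mult_distrib power_divide)
  have "deviation_rate * c = 2 * (slack i)\<^sup>2 * (c / p ^ Suc i)"
    unfolding sl deviation_rate_def using p_pos by simp
  also have "\<dots> \<le> 2 * (slack i)\<^sup>2 * real m" using assms by (intro mult_left_mono) auto
  finally show ?thesis by simp
qed

text \<open>
  Both tails of Hoeffding's inequality, divided by the lower bound \<open>2 * p * q\<close> for the probability
  of a nontrivial split.
\<close>

definition band_error :: "real \<Rightarrow> real" where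
  "band_error c = exp (- deviation_rate * c) / (p * q)"

lemma band_error_nonneg: "band_error c \<ge> 0"
  using p_pos q_pos by (simp add: band_error_def)

lemma split_bad_probability:
  assumes "c \<ge> 0" "real m \<ge> c / p ^ Suc i" "m \<ge> 2"
  shows "(\<Sum>l\<in>{l\<in>{0<..<m}. \<bar>real l - real m * p\<bar> \<ge> slack i * real m}. bin_weight m l) / split_norm m \<le> band_error c"
proof -
  have "(\<Sum>l\<in>{l\<in>{0<..<m}. \<bar>real l - real m * p\<bar> \<ge> slack i * real m}. bin_weight m l)
      \<le> 2 * exp (-2 * (slack i)\<^sup>2 * real m)"
    using assms slack_nonneg by (intro sum_bin_weight_deviation) auto
  also have "\<dots> \<le> 2 * exp (- deviation_rate * c)" using slack_deviation[OF assms(1,2)] by simp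
  finally have "(\<Sum>l\<in>{l\<in>{0<..<m}. \<bar>real l - real m * p\<bar> \<ge> slack i * real m}. bin_weight m l) / split_norm m
      \<le> 2 * exp (- deviation_rate * c) / (2 * p * q)"
    using split_norm_ge[OF assms(3)] p_pos q_pos by (intro frac_le) auto
  thus ?thesis by (simp add: band_error_def)
qed

lemma product_bound:
  fixes a b A B x y :: real
  assumes "a \<le> A + x" "b \<le> B + y" "0 \<le> A" "A \<le> 1" "0 \<le> b" "b \<le> 1" "0 \<le> x" "0 \<le> y"
  shows "a * b \<le> A * B + x + y"
proof -
  have "a * b \<le> (A + x) * b" using assms by (intro mult_right_mono) auto
  also have "\<dots> \<le> A * b + x" using assms mult_left_le[of b x] by (simp add: distrib_right)
  also have "A * b \<le> A * (B + y)" using assms by (intro mult_left_mono) auto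
  also have "\<dots> \<le> A * B + y" using assms mult_right_mono[of A 1 y] by (simp add: distrib_left)
  finally show ?thesis by simp
qed

text \<open>
  The classes form Pascal's triangle: with \<open>i\<close> splits left, \<open>j\<close> of them to the \<open>q\<close>-side, the
  \<open>p\<close>-part continues with \<open>(i - 1, j)\<close> and the \<open>q\<close>-part with \<open>(i - 1, j - 1)\<close>, independently, so the exponents
  \<open>i choose j\<close> add up. The second summand counts the splits that may go wrong:
  \<open>e i j = ((i + 2) choose (j + 1)) - 1\<close> solves \<open>e (i + 1) j = e i j + e i (j - 1) + 1\<close>. The
  case \<open>j = i + 1\<close>, where the claim is trivial, is included to make the recursion uniform.
\<close>

theorem height_cdf_le_band:
  assumes qp: "q \<le> p" and c: "real y + 2 \<le> c"
  shows "j \<le> Suc i \<Longrightarrow> (j \<le> i \<Longrightarrow> threshold c i j \<le> real m) \<Longrightarrow>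
    height_cdf (i + y) m \<le> (1 - tall_prob y) ^ (i choose j) + (real ((i + 2) choose (j + 1)) - 1) * band_error c"
proof (induction i arbitrary: j m)
  case 0
  show ?case
  proof (cases j)
    case 0
    hence "real y + 2 \<le> real m" using "0.prems" c by (simp add: threshold_def)
    hence "height_cdf y m \<le> 1 - tall_prob y" by (intro height_cdf_le_tall_prob) linarith
    thus ?thesis using 0 band_error_nonneg[of c] by simp
  next
    case (Suc j')
    hence "j = 1" using "0.prems" by simp
    thus ?thesis using height_cdf_le_1 by simp
  qed
next
  case (Suc i)
  have c0: "c \<ge> 0" using c by linarith
  have pi: "0 \<le> 1 - tall_prob y" "1 - tall_prob y \<le> 1" using tall_prob_pos[of y] tall_prob_le_1[of y] by auto
  show ?case
  proof (cases "j \<le> Suc i")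
    case False
    hence "j = Suc (Suc i)" using Suc.prems by simp
    thus ?thesis using height_cdf_le_1 by (simp add: binomial_eq_0)
  next
    case j: True
    have mt: "threshold c (Suc i) j \<le> real m" using Suc.prems j by simp
    have mc: "real m \<ge> c / p ^ Suc i" using threshold_ge[OF qp c0 j] mt by linarith
    have "c / 1 \<le> c / p ^ Suc i"
      using c0 p_pos p_less_1 power_le_one[of p "Suc i"] by (intro divide_left_mono) auto
    hence m2: "m \<ge> 2" using mc c by linarith
    define A x where "A = (1 - tall_prob y) ^ (i choose j)" and
      "x = (real ((i + 2) choose (j + 1)) - 1) * band_error c"
    \<comment> \<open>For \<open>j = 0\<close> nothing is required of the \<open>q\<close>-part.\<close>
    define B z where "B = (case j of 0 \<Rightarrow> 1 | Suc j' \<Rightarrow> (1 - tall_prob y) ^ (i choose j'))" and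
      "z = (case j of 0 \<Rightarrow> 0 | Suc j' \<Rightarrow> (real ((i + 2) choose (j' + 1)) - 1) * band_error c)"
    have A: "0 \<le> A" "A \<le> 1" using pi by (auto simp: A_def intro: power_le_one)
    have B: "0 \<le> B" using pi by (auto simp: B_def split: nat.splits)
    have xz: "0 \<le> x" "0 \<le> z"
    proof -
      have "1 \<le> real ((i + 2) choose (r + 1))" if "r \<le> Suc i" for r
        using zero_less_binomial[of "r + 1" "i + 2"] that by linarith
      thus "0 \<le> x" "0 \<le> z" using band_error_nonneg[of c] j
        by (auto simp: x_def z_def split: nat.splits simp del: binomial_Suc_Suc)
    qed
    define R where "R = A * B + x + z"
    have R0: "R \<ge> 0" using A B xz by (simp add: R_def)
    let ?bad = "{l\<in>{0<..<m}. \<bar>real l - real m * p\<bar> \<ge> slack i * real m}"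
    have good: "height_cdf (i + y) l * height_cdf (i + y) (m - l) \<le> R" if l: "l \<in> {0<..<m}" "l \<notin> ?bad" for l
    proof -
      have dev: "(p - slack i) * real m \<le> real l" "(q - slack i) * real m \<le> real (m - l)"
        using l by (auto simp: q_eq algebra_simps of_nat_diff abs_if split: if_splits)
      have sl: "0 \<le> q - slack i" "0 \<le> p - slack i" using slack_le_q[of i] qp by auto
      have "threshold c i j \<le> real l" if "j \<le> i"
        using threshold_step_p[OF qp c0 that] mult_left_mono[OF mt sl(2)] dev(1) by linarith
      hence 1: "height_cdf (i + y) l \<le> A + x" unfolding A_def x_def by (intro Suc.IH) (use j in auto)
      have 2: "height_cdf (i + y) (m - l) \<le> B + z"
      proof (cases j)
        case 0 thus ?thesis using height_cdf_le_1 by (simp add: B_def z_def)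
      next
        case (Suc j')
        have "threshold c i j' \<le> real (m - l)"
          using threshold_step_q[OF c0, of i j'] mult_left_mono[OF mt sl(1)] dev(2)
          unfolding Suc by linarith
        hence "height_cdf (i + y) (m - l) \<le> (1 - tall_prob y) ^ (i choose j') +
            (real ((i + 2) choose (j' + 1)) - 1) * band_error c"
          by (intro Suc.IH) (use j Suc in auto)
        thus ?thesis by (simp add: B_def z_def Suc)
      qed
      show ?thesis unfolding R_def using 1 2 A xz height_cdf_bounds by (intro product_bound) auto
    qed
    have "(\<Sum>l\<in>{0<..<m}. bin_weight m l * (height_cdf (i + y) l * height_cdf (i + y) (m - l)))
        \<le> (\<Sum>l\<in>{0<..<m}. (if l \<in> ?bad then bin_weight m l else 0) + bin_weight m l * R)"
    proof (intro sum_mono)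
      fix l assume l: "l \<in> {0<..<m}"
      have w: "bin_weight m l \<ge> 0" by (rule bin_weight_nonneg)
      show "bin_weight m l * (height_cdf (i + y) l * height_cdf (i + y) (m - l))
          \<le> (if l \<in> ?bad then bin_weight m l else 0) + bin_weight m l * R"
      proof (cases "l \<in> ?bad")
        case True
        have "bin_weight m l * (height_cdf (i + y) l * height_cdf (i + y) (m - l)) \<le> bin_weight m l * 1"
          using height_cdf_bounds by (intro mult_left_mono w) (auto intro: mult_le_one)
        moreover have "0 \<le> bin_weight m l * R" using w R0 by simp
        ultimately show ?thesis unfolding if_P[OF True] by linarith
      next
        case False
        show ?thesis unfolding if_not_P[OF False] using mult_left_mono[OF good[OF l False] w] by linarith
      qed
    qed
    also have "\<dots> = (\<Sum>l\<in>?bad. bin_weight m l) + split_norm m * R"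
      using sum_bin_weight[of m] m2
      by (simp add: sum.distrib sum_distrib_right[symmetric] sum.inter_filter[symmetric])
    finally have "height_cdf (Suc i + y) m \<le> ((\<Sum>l\<in>?bad. bin_weight m l) + split_norm m * R) / split_norm m"
      unfolding add_Suc height_cdf_Suc[OF m2] using split_norm_pos[OF m2] by (intro divide_right_mono) auto
    also have "\<dots> = (\<Sum>l\<in>?bad. bin_weight m l) / split_norm m + R"
      using split_norm_pos[OF m2] by (simp add: add_divide_distrib)
    also have "\<dots> \<le> band_error c + R" using split_bad_probability[OF c0 mc m2] by simp
    also have "\<dots> = (1 - tall_prob y) ^ (Suc i choose j) + (real ((Suc i + 2) choose (j + 1)) - 1) * band_error c"
    proof (cases j)
      case 0 thus ?thesis by (simp add: R_def A_def B_def x_def z_def algebra_simps)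
    next
      case (Suc j')
      have "real ((Suc i + 2) choose (j + 1)) = real ((i + 2) choose (j + 1)) + real ((i + 2) choose (j' + 1))"
        using Suc by simp
      thus ?thesis unfolding R_def A_def B_def x_def z_def
        using Suc by (simp add: algebra_simps power_add del: binomial_Suc_Suc) (simp add: power_add)
    qed
    finally show ?thesis .
  qed
qed

end

section \<open>From the distribution function to a law of large numbers\<close>

context bias
begin

text \<open>
  Leaving the window means exceeding every level below its upper end or staying within every level
  above its lower end, so one sequence of levels on each side controls the probability.
\<close>

lemma prob_height_deviation_tendsto_0:
  fixes a b :: "nat \<Rightarrow> real" and K1 K2 :: "nat \<Rightarrow> nat"
  assumes X: "\<And>n. finite (X n)" "\<And>n. card (X n) = n" and A: "\<And>n. finite (A n)"
    and bij: "\<And>n. bij_betw (\<phi> n) (X n) (A n)"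
    and process: "\<And>n. renyi_process p (X n) (A n) (\<phi> n) (M n) (Q n)"
    and H: "\<And>n \<omega>. H n \<omega> = renyi_height (X n) (\<phi> n) (\<lambda>j. Q n j \<omega>)"
    and K1: "\<forall>\<^sub>F n in sequentially. real (K1 n) \<le> a n + b n"
    and K2: "\<forall>\<^sub>F n in sequentially. a n - b n \<le> real (K2 n)"
    and upper: "(\<lambda>n. 1 - height_cdf (K1 n) n) \<longlonglongrightarrow> 0"
    and lower: "(\<lambda>n. height_cdf (K2 n) n) \<longlonglongrightarrow> 0"
  shows "(\<lambda>n. \<P>(\<omega> in M n. \<bar>real (H n \<omega>) - a n\<bar> > b n)) \<longlonglongrightarrow> 0"
proof (rule tendsto_sandwich[OF _ _ tendsto_const])
  show "(\<lambda>n. (1 - height_cdf (K1 n) n) + height_cdf (K2 n) n) \<longlonglongrightarrow> 0"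
    using tendsto_add[OF upper lower] by simp
  show "\<forall>\<^sub>F n in sequentially. \<P>(\<omega> in M n. \<bar>real (H n \<omega>) - a n\<bar> > b n)
      \<le> (1 - height_cdf (K1 n) n) + height_cdf (K2 n) n"
    using K1 K2 eventually_ge_at_top[of 1]
  proof eventually_elim
    case (elim n)
    interpret prob_space "M n" using process by (simp add: renyi_process_def)
    have ne: "X n \<noteq> {}" using X(2)[of n] elim(3) by auto
    have [measurable]: "H n \<in> M n \<rightarrow>\<^sub>M count_space UNIV"
      using measurable_renyi_height[OF process A X(1), of n] by (simp add: H[abs_def])
    have cdf: "\<P>(\<omega> in M n. H n \<omega> \<le> k) = height_cdf k n" for k
      using prob_height_le[OF X(1) A bij process ne] by (simp add: H X(2))
    have "\<P>(\<omega> in M n. \<bar>real (H n \<omega>) - a n\<bar> > b n)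
        \<le> prob ({\<omega> \<in> space (M n). \<not> H n \<omega> \<le> K1 n} \<union> {\<omega> \<in> space (M n). H n \<omega> \<le> K2 n})"
      using elim by (intro finite_measure_mono) (auto simp: abs_if split: if_splits)
    also have "\<dots> \<le> \<P>(\<omega> in M n. \<not> H n \<omega> \<le> K1 n) + \<P>(\<omega> in M n. H n \<omega> \<le> K2 n)"
      by (intro measure_Un_le) auto
    also have "\<P>(\<omega> in M n. \<not> H n \<omega> \<le> K1 n) = 1 - height_cdf (K1 n) n"
      by (subst prob_neg) (auto simp: cdf)
    finally show ?case by (simp add: cdf)
  qed
qed simp

section \<open>Upper bound for the biased process\<close>

text \<open>
  Pulling out \<open>p ^ i\<close> leaves the factors \<open>1 + (q / p) ^ i\<close>, whose product converges because
  \<open>q < p\<close>.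
\<close>

lemma descent_const_le_exp:
  assumes "q < p"
  shows "descent_const y \<le> exp (1 / (1 - q / p) + ln p * (real y * (real y + 3) / 2))"
proof -
  let ?\<rho> = "q / p"
  have \<rho>: "0 \<le> ?\<rho>" "?\<rho> < 1" using assms p_pos q_pos by auto
  have "descent_const y \<le> exp ((\<Sum>i<y. ?\<rho> ^ (i + 2)) + ln p * (real y * (real y + 3) / 2))"
  proof (induction y)
    case (Suc y)
    have "p ^ (y + 2) = exp (real (y + 2) * ln p)"
      unfolding exp_of_nat_mult using p_pos by simp
    hence e: "p ^ (y + 2) = exp (ln p * (real y + 2))" by (simp add: mult.commute)
    have "p ^ (y + 2) + q ^ (y + 2) = p ^ (y + 2) * (1 + ?\<rho> ^ (y + 2))"
      using p_pos by (simp add: power_divide distrib_left)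
    also have "\<dots> \<le> p ^ (y + 2) * exp (?\<rho> ^ (y + 2))"
      using p_pos exp_ge_add_one_self[of "?\<rho> ^ (y + 2)"] by (intro mult_left_mono) auto
    also have "\<dots> = exp (ln p * (real y + 2) + ?\<rho> ^ (y + 2))" by (simp only: e exp_add)
    finally have "descent_const (Suc y) \<le>
        exp ((\<Sum>i<y. ?\<rho> ^ (i + 2)) + ln p * (real y * (real y + 3) / 2)) * exp (ln p * (real y + 2) + ?\<rho> ^ (y + 2))"
      unfolding descent_const_def prod.lessThan_Suc
      using Suc p_pos q_pos unfolding descent_const_def by (intro mult_mono) auto
    also have "\<dots> = exp ((\<Sum>i<Suc y. ?\<rho> ^ (i + 2)) + ln p * (real (Suc y) * (real (Suc y) + 3) / 2))"
      by (simp only: exp_add[symmetric] sum.lessThan_Suc) (simp add: field_simps)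
    finally show ?case .
  qed (simp add: descent_const_def)
  also have "(\<Sum>i<y. ?\<rho> ^ (i + 2)) \<le> (\<Sum>i<y. ?\<rho> ^ i)"
    using \<rho> by (intro sum_mono power_decreasing) auto
  also have "\<dots> \<le> (\<Sum>i. ?\<rho> ^ i)"
    using \<rho> by (intro sum_le_suminf summable_geometric) auto
  also have "\<dots> = 1 / (1 - ?\<rho>)" using \<rho> by (intro suminf_geometric) auto
  finally show ?thesis by simp
qed

lemma exceedance_le_exp:
  assumes "q < p" "n \<ge> 1"
  shows "1 - height_cdf (k + y) n \<le> exp (1 / (1 - q / p) + ln p * (real y * (real y + 3) / 2)
    + real k * (q / p) ^ (y + 2) + real (y + 2) * (ln (real n) + real k * ln p))"
proof -
  let ?s = "y + 2"
  have "p ^ ?s + q ^ ?s = p ^ ?s * (1 + (q / p) ^ ?s)"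
    using p_pos by (simp add: power_divide distrib_left)
  also have "\<dots> \<le> exp (real ?s * ln p) * exp ((q / p) ^ ?s)"
    unfolding exp_of_nat_mult using p_pos q_pos exp_ge_add_one_self[of "(q / p) ^ ?s"] by (intro mult_mono) auto
  finally have "(p ^ ?s + q ^ ?s) ^ k \<le> (exp (real ?s * ln p) * exp ((q / p) ^ ?s)) ^ k"
    using p_pos q_pos by (intro power_mono) auto
  also have "\<dots> = exp (real k * (real ?s * ln p + (q / p) ^ ?s))"
    by (simp only: exp_add[symmetric] exp_of_nat_mult[symmetric])
  finally have 1: "(p ^ ?s + q ^ ?s) ^ k \<le> exp (real k * (real ?s * ln p + (q / p) ^ ?s))" .
  have 2: "real n ^ ?s = exp (real ?s * ln (real n))"
    unfolding exp_of_nat_mult using assms by simp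
  have "1 - height_cdf (k + y) n \<le> descent_const y * (p ^ ?s + q ^ ?s) ^ k * real n ^ ?s"
    by (rule exceedance_bound)
  also have "\<dots> \<le> exp (1 / (1 - q / p) + ln p * (real y * (real y + 3) / 2)) *
      exp (real k * (real ?s * ln p + (q / p) ^ ?s)) * exp (real ?s * ln (real n))"
    unfolding 2 using 1 descent_const_le_exp[OF assms(1), of y] p_pos q_pos
    by (intro mult_right_mono mult_mono) auto
  also have "\<dots> = exp (1 / (1 - q / p) + ln p * (real y * (real y + 3) / 2) +
      real k * (real ?s * ln p + (q / p) ^ ?s) + real ?s * ln (real n))"
    by (simp only: exp_add)
  finally show ?thesis by (simp add: algebra_simps)
qed

lemma biased_upper:
  assumes qp: "q < p" and \<epsilon>: "\<epsilon> > 0"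
  shows "\<exists>K. (\<forall>\<^sub>F n in sequentially. real (K n) \<le>
      log (1/p) (real n) + 1/2 * log (p/q) (ln (real n)) + \<epsilon> * ln (ln (real n))) \<and>
    (\<lambda>n. 1 - height_cdf (K n) n) \<longlonglongrightarrow> 0"
proof -
  define \<nu> \<mu> where "\<nu> = - ln p" and "\<mu> = ln (p / q)"
  have \<nu>: "\<nu> > 0" using p_pos p_less_1 by (simp add: \<nu>_def)
  have \<mu>: "\<mu> > 0" using qp q_pos by (simp add: \<mu>_def)
  have lnq: "ln (q / p) = - \<mu>" using p_pos q_pos by (simp add: \<mu>_def ln_div)
  have L: "log (1/p) x = ln x / \<nu>" for x using p_pos by (simp add: log_def ln_div \<nu>_def)
  have L': "log (p/q) x = ln x / \<mu>" for x by (simp add: log_def \<mu>_def)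
  define u where "u = (\<lambda>n :: nat. ln (ln (real n)))"
  \<comment> \<open>\<open>y\<close> is the least integer with \<open>(p / q) ^ y \<ge> ln n\<close>, so that \<open>k * (q / p) ^ (y + 2)\<close> stays
    bounded for \<open>k\<close> of order \<open>ln n\<close>; \<open>k\<close> then uses up the rest of the allowed height.\<close>
  define y where "y = (\<lambda>n. nat \<lceil>u n / \<mu>\<rceil>)"
  define k where "k = (\<lambda>n. nat \<lfloor>ln (real n) / \<nu> - u n / (2 * \<mu>) + \<epsilon> * u n - 1\<rfloor>)"
  define C where "C = 1 / (1 - q / p) + 2 / \<nu>"
  have ev: "\<forall>\<^sub>F n in sequentially. u n \<ge> 1 \<and> \<epsilon> * u n \<ge> 3 \<and> ln (real n) \<ge> 1 \<and> n \<ge> 1 \<and>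
      ln (real n) / \<nu> - u n / (2 * \<mu>) + \<epsilon> * u n - 1 \<ge> 0 \<and> \<epsilon> * u n \<le> ln (real n) / \<nu>"
    unfolding u_def using \<epsilon> \<nu> \<mu> by (intro eventually_conj eventually_ge_at_top; real_asymp)
  have "\<forall>\<^sub>F n in sequentially. real (k n + y n) \<le>
      log (1/p) (real n) + 1/2 * log (p/q) (ln (real n)) + \<epsilon> * ln (ln (real n))"
    using ev
  proof eventually_elim
    case (elim n)
    have "u n / \<mu> \<ge> 0" using elim \<mu> by simp
    hence "real (y n) \<le> u n / \<mu> + 1" unfolding y_def by linarith
    moreover have "real (k n) \<le> ln (real n) / \<nu> - u n / (2 * \<mu>) + \<epsilon> * u n - 1"
      unfolding k_def using elim by linarith
    ultimately show ?case unfolding L L' u_def by (simp add: field_simps)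
  qed
  moreover have "(\<lambda>n. 1 - height_cdf (k n + y n) n) \<longlonglongrightarrow> 0"
  proof (rule tendsto_sandwich[OF _ _ tendsto_const])
    show "\<forall>\<^sub>F n in sequentially. 0 \<le> 1 - height_cdf (k n + y n) n"
      using height_cdf_le_1 by simp
    show "(\<lambda>n. exp (C + \<nu> * (3 - \<epsilon> * u n))) \<longlonglongrightarrow> 0"
      unfolding u_def using \<epsilon> \<nu> by real_asymp
    show "\<forall>\<^sub>F n in sequentially. 1 - height_cdf (k n + y n) n \<le> exp (C + \<nu> * (3 - \<epsilon> * u n))"
      using ev
    proof eventually_elim
      case (elim n)
      define t where "t = ln (real n)"
      have t: "t \<ge> 1" using elim by (simp add: t_def)
      have ut: "exp (u n) = t" unfolding u_def t_def by (rule exp_ln) (use elim in linarith)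
      have y: "real (y n) \<ge> u n / \<mu>" unfolding y_def by linarith
      have k: "real (k n) \<ge> t / \<nu> - u n / (2 * \<mu>) + \<epsilon> * u n - 2" "real (k n) \<le> 2 * t / \<nu>"
      proof -
        show "real (k n) \<ge> t / \<nu> - u n / (2 * \<mu>) + \<epsilon> * u n - 2" unfolding k_def t_def by linarith
        have "u n / (2 * \<mu>) \<ge> 0" using elim \<mu> by simp
        hence "real (k n) \<le> t / \<nu> + \<epsilon> * u n" using elim unfolding k_def t_def by linarith
        thus "real (k n) \<le> 2 * t / \<nu>" using elim by (simp add: t_def)
      qed
      have "(q / p) ^ (y n + 2) = exp (real (y n + 2) * - \<mu>)"
        unfolding exp_of_nat_mult lnq[symmetric] using p_pos q_pos by simp
      also have "\<dots> \<le> exp (- u n)"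
      proof -
        have "u n \<le> real (y n) * \<mu>" using y \<mu> by (simp add: field_simps)
        also have "\<dots> \<le> real (y n + 2) * \<mu>" using \<mu> by (intro mult_right_mono) auto
        finally show ?thesis by simp
      qed
      also have "\<dots> = 1 / t" by (simp add: exp_minus ut inverse_eq_divide)
      finally have "real (k n) * (q / p) ^ (y n + 2) \<le> (2 * t / \<nu>) * (1 / t)"
        using k(2) p_pos q_pos by (intro mult_mono) auto
      hence A: "real (k n) * (q / p) ^ (y n + 2) \<le> 2 / \<nu>" using t by simp
      have "t + real (k n) * ln p = \<nu> * (t / \<nu> - real (k n))"
        using \<nu> by (simp add: \<nu>_def field_simps)
      also have "\<dots> \<le> \<nu> * (u n / (2 * \<mu>) - \<epsilon> * u n + 2)"
        using k(1) \<nu> by (intro mult_left_mono) auto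
      also have "\<dots> \<le> \<nu> * (real (y n) / 2 - \<epsilon> * u n + 2)"
        using y \<nu> by (intro mult_left_mono) auto
      finally have "real (y n + 2) * (t + real (k n) * ln p) \<le> real (y n + 2) * (\<nu> * (real (y n) / 2 - \<epsilon> * u n + 2))"
        by (intro mult_left_mono) auto
      moreover have "ln p * (real (y n) * (real (y n) + 3) / 2) = - \<nu> * (real (y n) * (real (y n) + 3) / 2)"
        by (simp add: \<nu>_def)
      moreover have "\<nu> * (a * b - d) = - \<nu> * d + a * (\<nu> * b)" for a b d :: real
        by (simp add: algebra_simps)
      ultimately have "ln p * (real (y n) * (real (y n) + 3) / 2) + real (y n + 2) * (t + real (k n) * ln p)
          \<le> \<nu> * (real (y n + 2) * (real (y n) / 2 - \<epsilon> * u n + 2) - real (y n) * (real (y n) + 3) / 2)"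
        by simp
      also have "\<dots> \<le> \<nu> * (3 - \<epsilon> * u n)"
      proof (intro mult_left_mono)
        have "real (y n) * (3/2 - \<epsilon> * u n) \<le> 0"
          using elim by (intro mult_nonneg_nonpos) auto
        thus "real (y n + 2) * (real (y n) / 2 - \<epsilon> * u n + 2) - real (y n) * (real (y n) + 3) / 2 \<le> 3 - \<epsilon> * u n"
          using elim by (simp add: algebra_simps add_divide_distrib)
      qed (use \<nu> in auto)
      finally have B: "ln p * (real (y n) * (real (y n) + 3) / 2) + real (y n + 2) * (t + real (k n) * ln p) \<le> \<nu> * (3 - \<epsilon> * u n)" .
      have "1 - height_cdf (k n + y n) n \<le> exp (1 / (1 - q / p) + ln p * (real (y n) * (real (y n) + 3) / 2)
          + real (k n) * (q / p) ^ (y n + 2) + real (y n + 2) * (t + real (k n) * ln p))"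
        unfolding t_def using elim by (intro exceedance_le_exp qp) auto
      also have "\<dots> \<le> exp (C + \<nu> * (3 - \<epsilon> * u n))"
        using A B unfolding exp_le_cancel_iff C_def by linarith
      finally show ?case .
    qed
  qed
  ultimately show ?thesis by (intro exI[of _ "\<lambda>n. k n + y n"] conjI)
qed


section \<open>Upper bound for the symmetric process\<close>

text \<open>
  For \<open>p = q\<close> the factors are powers of 2 and have to be kept exactly: estimating
  \<open>1 + (q / p) ^ s = 2\<close> by an exponential would lose a factor exponential in \<open>k\<close>.
\<close>

lemma exceedance_symmetric:
  assumes "p = q" "n \<ge> 1"
  shows "1 - height_cdf (k + y) n \<le>
    2 powr (log 2 (real n) + (real y + 1) * (log 2 (real n) - real k - real y / 2))"
proof -
  have p: "p = 1/2" "q = 1/2" using assms p_plus_q by auto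
  have half: "p ^ (i + 2) + q ^ (i + 2) = 2 powr - (real i + 1)" for i
  proof -
    have "2 powr - (real i + 1) = 1 / 2 ^ Suc i"
      using powr_realpow[of 2 "Suc i"] by (simp only: powr_minus_divide) (simp add: add.commute)
    thus ?thesis by (simp add: p power_divide field_simps)
  qed
  have c: "descent_const y = 2 powr - (real y * (real y + 1) / 2)"
  proof (induction y)
    case (Suc y)
    have "descent_const (Suc y) = 2 powr - (real y * (real y + 1) / 2) * 2 powr - (real y + 1)"
      using Suc by (simp add: descent_const_def half del: power_Suc add_2_eq_Suc add_2_eq_Suc')
    also have "\<dots> = 2 powr - (real (Suc y) * (real (Suc y) + 1) / 2)"
    proof -
      have "- (real y * (real y + 1) / 2) + - (real y + 1) = - (real (Suc y) * (real (Suc y) + 1) / 2)"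
        by (simp add: algebra_simps add_divide_distrib)
      thus ?thesis by (simp only: powr_add[symmetric])
    qed
    finally show ?case .
  qed (simp add: descent_const_def)
  have n: "real n = 2 powr log 2 (real n)" using assms by simp
  have "1 - height_cdf (k + y) n \<le> descent_const y * (p ^ (y + 2) + q ^ (y + 2)) ^ k * real n ^ (y + 2)"
    by (rule exceedance_bound)
  also have "(p ^ (y + 2) + q ^ (y + 2)) ^ k = 2 powr (- (real y + 1) * real k)"
    unfolding half powr_powr[symmetric] by (simp add: powr_realpow)
  also have "real n ^ (y + 2) = 2 powr (log 2 (real n) * real (y + 2))"
    unfolding powr_powr[symmetric] n[symmetric] using assms by (subst powr_realpow) auto
  finally show ?thesis
    unfolding c powr_add[symmetric] by (simp add: field_simps)
qed

lemma symmetric_upper: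
  assumes pq: "p = q" and \<epsilon>: "\<epsilon> > 0"
  shows "\<exists>K. (\<forall>\<^sub>F n in sequentially. real (K n) \<le>
      log 2 (real n) + sqrt (2 * log 2 (real n)) + \<epsilon> * sqrt (ln (real n))) \<and>
    (\<lambda>n. 1 - height_cdf (K n) n) \<longlonglongrightarrow> 0"
proof -
  define L where "L = (\<lambda>n :: nat. log 2 (real n))"
  define w where "w = (\<lambda>n. sqrt (2 * L n))"
  define d where "d = (\<lambda>n :: nat. \<epsilon> * sqrt (ln (real n)))"
  \<comment> \<open>The exponent in the preceding lemma is a quadratic polynomial in \<open>y\<close>, and with
    \<open>y\<close> close to \<open>w n\<close> its leading term \<open>- y\<^sup>2 / 2\<close> cancels the term \<open>log 2 n\<close>.\<close>
  define y where "y = (\<lambda>n. nat \<lfloor>w n\<rfloor>)"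
  define k where "k = (\<lambda>n. nat \<lfloor>L n + d n\<rfloor>)"
  have ev: "\<forall>\<^sub>F n in sequentially. n \<ge> 1 \<and> L n \<ge> 1 \<and> d n \<ge> 2"
    unfolding L_def d_def using \<epsilon> by (intro eventually_conj eventually_ge_at_top; real_asymp)
  have "\<forall>\<^sub>F n in sequentially. real (k n + y n) \<le>
      log 2 (real n) + sqrt (2 * log 2 (real n)) + \<epsilon> * sqrt (ln (real n))"
    using ev
  proof eventually_elim
    case (elim n)
    have "w n \<ge> 0" using elim by (simp add: w_def)
    hence "real (y n) \<le> w n" "real (k n) \<le> L n + d n" using elim unfolding y_def k_def by linarith+
    thus ?case by (simp add: L_def w_def d_def)
  qed
  moreover have "(\<lambda>n. 1 - height_cdf (k n + y n) n) \<longlonglongrightarrow> 0"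
  proof (rule tendsto_sandwich[OF _ _ tendsto_const])
    show "\<forall>\<^sub>F n in sequentially. 0 \<le> 1 - height_cdf (k n + y n) n"
      using height_cdf_le_1 by simp
    show "(\<lambda>n. 2 powr (w n * (3/2 - d n))) \<longlonglongrightarrow> 0"
      unfolding w_def d_def L_def using \<epsilon> by real_asymp
    show "\<forall>\<^sub>F n in sequentially. 1 - height_cdf (k n + y n) n \<le> 2 powr (w n * (3/2 - d n))"
      using ev
    proof eventually_elim
      case (elim n)
      have w: "w n \<ge> 0" "w n * w n = 2 * L n" using elim by (auto simp: w_def)
      have y: "w n \<le> real (y n) + 1" "real (y n) \<ge> w n - 1" unfolding y_def by linarith+
      have k: "L n - real (k n) \<le> 1 - d n" unfolding k_def by linarith
      have "(real (y n) + 1) * (L n - real (k n) - real (y n) / 2) \<le> (real (y n) + 1) * (1 - d n - (w n - 1) / 2)"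
        proof (intro mult_left_mono)
        have "(w n - 1) / 2 \<le> real (y n) / 2" using y(2) by (rule divide_right_mono) simp
        with k show "L n - real (k n) - real (y n) / 2 \<le> 1 - d n - (w n - 1) / 2" by (rule diff_mono)
      qed simp
      also have "\<dots> \<le> w n * (1 - d n - (w n - 1) / 2)"
        using y(1) w(1) elim by (intro mult_right_mono_neg) auto
      also have "\<dots> = w n * (3/2 - d n) - L n" using w(2) by (simp add: algebra_simps diff_divide_distrib add_divide_distrib)
      finally have le: "L n + (real (y n) + 1) * (L n - real (k n) - real (y n) / 2) \<le> w n * (3/2 - d n)" by simp
      have "1 - height_cdf (k n + y n) n \<le> 2 powr (L n + (real (y n) + 1) * (L n - real (k n) - real (y n) / 2))"
        unfolding L_def using elim by (intro exceedance_symmetric pq) auto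
      also have "\<dots> \<le> 2 powr (w n * (3/2 - d n))" using le by simp
      finally show ?case .
    qed
  qed
  ultimately show ?thesis by (intro exI[of _ "\<lambda>n. k n + y n"] conjI)
qed

section \<open>Lower bounds\<close>

lemma ln_tall_prob: "ln (tall_prob y) = ln p * (real y * (real y + 3) / 2) + ln q * real y"
proof (induction y)
  case (Suc y)
  have "tall_prob (Suc y) = tall_prob y * (p ^ (y + 2) * q)" by (simp add: tall_prob_def)
  hence "ln (tall_prob (Suc y)) = ln (tall_prob y) + ((real y + 2) * ln p + ln q)"
    using tall_prob_pos[of y] p_pos q_pos by (simp add: ln_mult_pos ln_realpow algebra_simps)
  thus ?case unfolding Suc by (simp add: field_simps)
qed (simp add: tall_prob_def)

text \<open>
  The band estimate in the form used below; the premise on \<open>n\<close> bounds \<^const>\<open>threshold\<close> by replacing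
  its factor \<open>2 - sqrt p ^ i\<close> by 2.
\<close>

lemma height_cdf_le_exp:
  assumes qp: "q \<le> p" and c: "real y + 2 \<le> c" and j: "j \<le> i"
    and n: "2 * c / (p ^ (i - j) * q ^ j) \<le> real n"
  shows "height_cdf (i + y) n \<le> exp (- (tall_prob y * real (i choose j))) +
    real ((i + 2) choose (j + 1)) * band_error c"
proof -
  have "threshold c i j \<le> real n" using threshold_le[of c i j] n c by linarith
  hence "height_cdf (i + y) n \<le> (1 - tall_prob y) ^ (i choose j) + (real ((i + 2) choose (j + 1)) - 1) * band_error c"
    using j by (intro height_cdf_le_band qp c) auto
  also have "(1 - tall_prob y) ^ (i choose j) \<le> exp (- tall_prob y) ^ (i choose j)"
    using exp_ge_add_one_self[of "- tall_prob y"] tall_prob_le_1[of y] by (intro power_mono) auto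
  also have "\<dots> = exp (- (tall_prob y * real (i choose j)))"
    by (simp add: exp_of_nat_mult[symmetric] mult.commute)
  also have "(real ((i + 2) choose (j + 1)) - 1) * band_error c \<le> real ((i + 2) choose (j + 1)) * band_error c"
    using band_error_nonneg[of c] by (intro mult_right_mono) auto
  finally show ?thesis by simp
qed

text \<open>
  The central binomial coefficient \<open>(2 * j) choose j\<close> loses only a factor of order \<open>log 2 n\<close> against
  the number \<open>2 ^ (2 * j)\<close> of all classes, so the two-parameter band also serves the symmetric
  process.
\<close>

lemma symmetric_lower:
  assumes pq: "p = q" and \<epsilon>: "\<epsilon> > 0"
  shows "\<exists>K. (\<forall>\<^sub>F n in sequentially.
      log 2 (real n) + sqrt (2 * log 2 (real n)) - \<epsilon> * sqrt (ln (real n)) \<le> real (K n)) \<and>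
    (\<lambda>n. height_cdf (K n) n) \<longlonglongrightarrow> 0"
proof -
  have p: "p = 1/2" "q = 1/2" using pq p_plus_q by auto
  obtain \<delta> where \<delta>: "0 < \<delta>" "\<delta> < 1" "\<delta> * sqrt 2 / sqrt (ln 2) < \<epsilon>"
  proof
    define r where "r = \<epsilon> * sqrt (ln 2) / sqrt 2"
    have r: "r > 0" using \<epsilon> by (simp add: r_def)
    show "0 < min (1/2) (r / 2)" "min (1/2) (r / 2) < 1" using r by auto
    have "min (1/2) (r / 2) * sqrt 2 < r * sqrt 2" using r by (intro mult_strict_right_mono) auto
    also have "\<dots> = \<epsilon> * sqrt (ln 2)" by (simp add: r_def)
    finally show "min (1/2) (r / 2) * sqrt 2 / sqrt (ln 2) < \<epsilon>" by (simp add: divide_less_eq)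
  qed
  \<comment> \<open>Size \<open>c\<close> must make \<open>n * exp (- deviation_rate * c)\<close> small, hence exceed every multiple of
    \<open>ln n\<close>, while \<open>log 2 c\<close> has to be negligible against \<open>sqrt (ln n)\<close>.\<close>
  define c where "c = (\<lambda>n :: nat. (ln (real n))\<^sup>2)"
  define v where "v = (\<lambda>n :: nat. log 2 (real n) - log 2 (2 * c n))"
  define w where "w = (\<lambda>n :: nat. (1 - \<delta>) * sqrt (2 * log 2 (real n)))"
  define j where "j = (\<lambda>n. nat \<lfloor>v n / 2\<rfloor>)"
  define y where "y = (\<lambda>n. nat \<lfloor>w n\<rfloor>)"
  define \<gamma> where "\<gamma> = \<epsilon> - \<delta> * sqrt 2 / sqrt (ln 2)"
  have \<gamma>: "\<gamma> > 0" using \<delta> by (simp add: \<gamma>_def)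
  have "\<forall>\<^sub>F n in sequentially. c n \<ge> 1" unfolding c_def by real_asymp
  moreover have "\<forall>\<^sub>F n in sequentially. v n \<ge> 4" unfolding v_def c_def by real_asymp
  moreover have "\<forall>\<^sub>F n in sequentially. w n + 2 \<le> c n" unfolding w_def c_def using \<delta> by real_asymp
  moreover have "\<forall>\<^sub>F n in sequentially. log 2 (2 * c n) + 3 \<le> \<gamma> * sqrt (ln (real n))"
    unfolding c_def using \<gamma> by real_asymp
  ultimately have ev: "\<forall>\<^sub>F n in sequentially. n \<ge> 2 \<and> c n \<ge> 1 \<and> v n \<ge> 4 \<and> w n \<ge> 0 \<and> w n + 2 \<le> c n \<and>
      log 2 (real n) + sqrt (2 * log 2 (real n)) - \<epsilon> * sqrt (ln (real n)) \<le> v n - 2 + w n - 1"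
    using eventually_ge_at_top[of 2]
  proof eventually_elim
    case (elim n)
    have "sqrt (2 * log 2 (real n)) = sqrt 2 / sqrt (ln 2) * sqrt (ln (real n))"
      by (simp add: log_def real_sqrt_mult real_sqrt_divide)
    hence "\<gamma> * sqrt (ln (real n)) = \<epsilon> * sqrt (ln (real n)) - \<delta> * sqrt (2 * log 2 (real n))"
      by (simp add: \<gamma>_def left_diff_distrib)
    moreover have "w n = sqrt (2 * log 2 (real n)) - \<delta> * sqrt (2 * log 2 (real n))"
      by (simp add: w_def left_diff_distrib)
    moreover have "w n \<ge> 0" using \<delta> elim by (simp add: w_def)
    ultimately show ?case using elim unfolding v_def by linarith
  qed
  have "\<forall>\<^sub>F n in sequentially.
      log 2 (real n) + sqrt (2 * log 2 (real n)) - \<epsilon> * sqrt (ln (real n)) \<le> real (2 * j n + y n)"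
    using ev
  proof eventually_elim
    case (elim n)
    have "v n - 2 \<le> real (2 * j n)" "w n - 1 \<le> real (y n)" unfolding j_def y_def by linarith+
    thus ?case using elim by simp
  qed
  moreover have "(\<lambda>n. height_cdf (2 * j n + y n) n) \<longlonglongrightarrow> 0"
  proof (rule tendsto_sandwich[OF _ _ tendsto_const])
    show "\<forall>\<^sub>F n in sequentially. 0 \<le> height_cdf (2 * j n + y n) n"
      using height_cdf_nonneg by simp
    \<comment> \<open>A lower bound for the base-2 logarithm of \<^const>\<open>tall_prob\<close> times the number of classes.\<close>
    define g where "g = (\<lambda>n. v n - 2 - log 2 (v n) - w n * (w n + 5) / 2)"
    show "(\<lambda>n. exp (- (2 powr g n)) + 16 * real n * exp (- (deviation_rate * c n))) \<longlonglongrightarrow> 0"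
    proof -
      \<comment> \<open>The part of \<open>log 2 n\<close> that is left after subtracting \<open>(w n)\<^sup>2 / 2\<close>.\<close>
      define \<eta> where "\<eta> = 1 - (1 - \<delta>)\<^sup>2"
      have "(1 - \<delta>) * (1 - \<delta>) < 1 * 1" using \<delta> by (intro mult_strict_mono) auto
      hence \<eta>: "\<eta> > 0" by (simp add: \<eta>_def power2_eq_square)
      have "\<forall>\<^sub>F n in sequentially. \<eta> * log 2 (real n) - log 2 (2 * c n) - 2 - log 2 (v n) - 5 * w n / 2 = g n"
        using eventually_ge_at_top[of 1]
      proof eventually_elim
        case (elim n)
        have "w n * w n = (1 - \<delta>)\<^sup>2 * (2 * log 2 (real n))"
          unfolding w_def power2_eq_square using elim by simp
        thus ?case by (simp add: g_def v_def \<eta>_def algebra_simps add_divide_distrib)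
      qed
      moreover have "filterlim (\<lambda>n. \<eta> * log 2 (real n) - log 2 (2 * c n) - 2 - log 2 (v n) - 5 * w n / 2) at_top sequentially"
        unfolding v_def w_def c_def using \<eta> \<delta> by real_asymp
      ultimately have "filterlim g at_top sequentially"
        by (rule filterlim_mono_eventually[OF _ order_refl order_refl, rotated])
      hence "(\<lambda>n. exp (- (2 powr g n))) \<longlonglongrightarrow> 0"
        by (rule filterlim_compose[rotated]) real_asymp
      moreover have "(\<lambda>n. 16 * real n * exp (- (deviation_rate * c n))) \<longlonglongrightarrow> 0"
        unfolding c_def using deviation_rate_pos by real_asymp
      ultimately show ?thesis using tendsto_add by fastforce
    qed
    show "\<forall>\<^sub>F n in sequentially. height_cdf (2 * j n + y n) n \<le>
        exp (- (2 powr g n)) + 16 * real n * exp (- (deviation_rate * c n))"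
      using ev
    proof eventually_elim
      case (elim n)
      have y: "real (y n) \<le> w n" using elim unfolding y_def by linarith
      have j: "real (2 * j n) \<le> v n" "v n - 2 \<le> real (2 * j n)" using elim unfolding j_def by linarith+
      have j1: "j n \<ge> 1" using elim j by linarith
      have "2 powr real (2 * j n) \<le> 2 powr v n" using j by simp
      also have "\<dots> = real n / (2 * c n)"
        using elim by (simp add: v_def powr_diff)
      finally have pow: "2 ^ (2 * j n) \<le> real n / (2 * c n)" by (subst (asm) powr_realpow) auto
      have n: "2 * c n / (p ^ (2 * j n - j n) * q ^ j n) \<le> real n"
      proof -
        have "p ^ (2 * j n - j n) * q ^ j n = 1 / 2 ^ (2 * j n)"
          by (simp add: p power_divide mult_2 power_add)
        hence "2 * c n / (p ^ (2 * j n - j n) * q ^ j n) = 2 * c n * 2 ^ (2 * j n)" by simp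
        thus ?thesis using pow elim by (simp add: field_simps)
      qed
      have tall: "tall_prob (y n) = 2 powr - (real (y n) * (real (y n) + 5) / 2)"
      proof -
        have "ln (tall_prob (y n)) = - (real (y n) * (real (y n) + 5) / 2) * ln 2"
          unfolding ln_tall_prob p(1)[THEN arg_cong, of ln] p(2)[THEN arg_cong, of ln] by (simp add: ln_div field_simps)
        hence "exp (ln (tall_prob (y n))) = 2 powr - (real (y n) * (real (y n) + 5) / 2)"
          by (simp add: powr_def)
        thus ?thesis using tall_prob_pos by simp
      qed
      have "2 powr g n = 2 powr - (w n * (w n + 5) / 2) * (2 powr (v n - 2) / v n)"
      proof -
        have "g n = - (w n * (w n + 5) / 2) + ((v n - 2) - log 2 (v n))" by (simp add: g_def)
        thus ?thesis using elim by (simp only: powr_add powr_diff) simp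
      qed
      also have "\<dots> \<le> tall_prob (y n) * (2 powr real (2 * j n) / real (2 * j n))"
        unfolding tall using y j j1 elim
        by (intro mult_mono frac_le powr_mono) (auto intro!: mult_mono divide_right_mono)
      also have "2 powr real (2 * j n) / real (2 * j n) = 4 ^ j n / (2 * real (j n))"
        by (subst powr_realpow) (auto simp: power_mult)
      also have "tall_prob (y n) * (4 ^ j n / (2 * real (j n))) \<le> tall_prob (y n) * real (2 * j n choose j n)"
        using central_binomial_lower_bound[of "j n"] j1 tall_prob_pos[of "y n"] by (intro mult_left_mono) auto
      finally have main: "2 powr g n \<le> tall_prob (y n) * real (2 * j n choose j n)" .
      have "real ((2 * j n + 2) choose (j n + 1)) \<le> 2 ^ (2 * j n + 2)"
        using of_nat_mono[OF binomial_le_pow2[of "2 * j n + 2" "j n + 1"], where 'a = real]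
        by (simp only: of_nat_power of_nat_numeral)
      also have "\<dots> = 4 * 2 ^ (2 * j n)" by simp
      also have "\<dots> \<le> 4 * (real n / (2 * c n))" using pow by simp
      also have "\<dots> \<le> 4 * (real n / 1)" using elim by (intro mult_left_mono divide_left_mono) auto
      finally have "real ((2 * j n + 2) choose (j n + 1)) \<le> 4 * real n" by simp
      moreover have "p * q = 1 / 4" by (simp add: p)
      hence "band_error (c n) = 4 * exp (- (deviation_rate * c n))" unfolding band_error_def by (simp only:) simp
      ultimately have err: "real ((2 * j n + 2) choose (j n + 1)) * band_error (c n) \<le>
          4 * real n * (4 * exp (- (deviation_rate * c n)))"
        by (simp only:) (intro mult_right_mono, auto)
      have "height_cdf (2 * j n + y n) n \<le> exp (- (tall_prob (y n) * real (2 * j n choose j n))) +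
          real ((2 * j n + 2) choose (j n + 1)) * band_error (c n)"
        using n y elim pq by (intro height_cdf_le_exp) auto
      also have "\<dots> \<le> exp (- (2 powr g n)) + 16 * real n * exp (- (deviation_rate * c n))"
        using main err by (intro add_mono) auto
      finally show ?case .
    qed
  qed
  ultimately show ?thesis by (intro exI[of _ "\<lambda>n. 2 * j n + y n"] conjI)
qed


text \<open>
  With \<open>j\<close> close to \<open>\<beta> * u\<close>, where \<open>u = ln (ln n)\<close>, there are about \<open>exp (\<beta> * u\<^sup>2)\<close> classes, and a subtree of
  height \<open>\<alpha> * u\<close> has probability about \<open>exp (- \<nu> * \<alpha>\<^sup>2 * u\<^sup>2 / 2)\<close>. The total height exceeds
  \<open>log (1/p) n\<close> by \<open>(\<alpha> - \<beta> * \<mu> / \<nu>) * u\<close>; maximizing this subject to \<open>\<beta> = \<nu> * \<alpha>\<^sup>2 / 2\<close> gives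
  \<open>\<alpha> = 1 / \<mu>\<close> and \<open>\<beta> = \<nu> / (2 * \<mu>\<^sup>2)\<close>. Lowering \<open>\<alpha>\<close> by \<open>\<delta>\<close> makes the classes outweigh the
  probability. Here \<open>\<nu> = - ln p\<close> and \<open>\<mu> = ln (p / q)\<close>.
\<close>

lemma biased_lower:
  assumes qp: "q < p" and \<epsilon>: "\<epsilon> > 0"
  shows "\<exists>K. (\<forall>\<^sub>F n in sequentially.
      log (1/p) (real n) + 1/2 * log (p/q) (ln (real n)) - \<epsilon> * ln (ln (real n)) \<le> real (K n)) \<and>
    (\<lambda>n. height_cdf (K n) n) \<longlonglongrightarrow> 0"
proof -
  define \<nu> \<mu> \<tau> where "\<nu> = - ln p" and "\<mu> = ln (p / q)" and "\<tau> = - ln q"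
  have \<nu>: "\<nu> > 0" using p_pos p_less_1 by (simp add: \<nu>_def)
  have \<tau>: "\<tau> > 0" using q_pos q_less_1 by (simp add: \<tau>_def)
  have \<mu>: "\<mu> > 0" using qp q_pos by (simp add: \<mu>_def)
  have \<tau>_eq: "\<tau> = \<nu> + \<mu>" using p_pos q_pos by (simp add: \<mu>_def \<nu>_def \<tau>_def ln_div)
  have L: "log (1/p) x = ln x / \<nu>" for x using p_pos by (simp add: log_def ln_div \<nu>_def)
  have L': "log (p/q) x = ln x / \<mu>" for x by (simp add: log_def \<mu>_def)
  define \<kappa> where "\<kappa> = deviation_rate"
  have \<kappa>: "\<kappa> > 0" using deviation_rate_pos by (simp add: \<kappa>_def)
  define \<delta> where "\<delta> = min (\<epsilon> / 2) (1 / (2 * \<mu>))"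
  have \<delta>: "0 < \<delta>" "\<delta> < \<epsilon>" "\<delta> < 1 / \<mu>" using \<epsilon> \<mu> by (auto simp: \<delta>_def min_less_iff_disj field_simps)
  define \<alpha> \<beta> where "\<alpha> = 1 / \<mu> - \<delta>" and "\<beta> = \<nu> / (2 * \<mu>\<^sup>2)"
  have \<alpha>: "\<alpha> > 0" using \<delta> by (simp add: \<alpha>_def)
  have \<beta>: "\<beta> > 0" using \<nu> \<mu> by (simp add: \<beta>_def)
  have gap: "\<beta> - \<nu> * \<alpha>\<^sup>2 / 2 > 0"
  proof -
    have "\<alpha>\<^sup>2 < (1 / \<mu>)\<^sup>2" using \<alpha> \<delta> by (intro power_strict_mono) (auto simp: \<alpha>_def)
    hence "\<nu> * \<alpha>\<^sup>2 / 2 < \<nu> * (1 / \<mu>)\<^sup>2 / 2" using \<nu> by simp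
    thus ?thesis by (simp add: \<beta>_def power_divide mult.commute)
  qed
  define u where "u = (\<lambda>n :: nat. ln (ln (real n)))"
  \<comment> \<open>The number of splits that may go wrong is at most about \<open>exp (2 * \<beta> * u\<^sup>2)\<close>, so \<open>c\<close> must exceed every multiple of
    \<open>u\<^sup>2\<close>, while \<open>ln c\<close> has to be negligible against \<open>u\<close>.\<close>
  define c where "c = (\<lambda>n. u n ^ 3)"
  define y where "y = (\<lambda>n. nat \<lfloor>\<alpha> * u n\<rfloor>)"
  define j where "j = (\<lambda>n. nat \<lfloor>\<beta> * u n\<rfloor>)"
  \<comment> \<open>\<open>I n\<close> is the level at which the classes in question have size \<open>2 * c n\<close>.\<close>
  define I where "I = (\<lambda>n. (ln (real n) - ln (2 * c n) - \<mu> * (\<beta> * u n)) / \<nu>)"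
  define i where "i = (\<lambda>n. nat \<lfloor>I n\<rfloor>)"
  have u_top: "filterlim u at_top sequentially" unfolding u_def by real_asymp
  have "\<forall>\<^sub>F n in sequentially. u n \<ge> 1" unfolding u_def by real_asymp
  moreover have "\<forall>\<^sub>F n in sequentially. \<alpha> * u n + 2 \<le> c n" unfolding c_def u_def using \<alpha> by real_asymp
  moreover have "\<forall>\<^sub>F n in sequentially. \<beta> * u n \<ge> 2" unfolding u_def using \<beta> by real_asymp
  moreover have "\<forall>\<^sub>F n in sequentially. I n - 1 \<ge> ln (real n) / (2 * \<nu>)"
    unfolding I_def c_def u_def using \<beta> \<mu> \<nu> by real_asymp
  moreover have "\<forall>\<^sub>F n in sequentially. ln (real n) / (2 * \<nu>) \<ge> \<beta> * u n"
    unfolding u_def using \<beta> \<nu> by real_asymp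
  moreover have "\<forall>\<^sub>F n in sequentially. ln (real n) / \<nu> + 2 \<le> (ln (real n))\<^sup>2" using \<nu> by real_asymp
  moreover have "\<forall>\<^sub>F n in sequentially. ln (2 * c n) / \<nu> + 2 \<le> (\<epsilon> - \<delta>) * u n"
    unfolding c_def u_def using \<nu> \<delta> by real_asymp
  ultimately have ev: "\<forall>\<^sub>F n in sequentially. n \<ge> 2 \<and> u n \<ge> 1 \<and> \<alpha> * u n + 2 \<le> c n \<and> \<beta> * u n \<ge> 2 \<and>
      I n - 1 \<ge> ln (real n) / (2 * \<nu>) \<and> ln (real n) / (2 * \<nu>) \<ge> \<beta> * u n \<and>
      ln (real n) / \<nu> + 2 \<le> (ln (real n))\<^sup>2 \<and> ln (2 * c n) / \<nu> + 2 \<le> (\<epsilon> - \<delta>) * u n"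
    using eventually_ge_at_top[of 2] by eventually_elim blast
  have "\<forall>\<^sub>F n in sequentially.
      log (1/p) (real n) + 1/2 * log (p/q) (ln (real n)) - \<epsilon> * ln (ln (real n)) \<le> real (i n + y n)"
    using ev
  proof eventually_elim
    case (elim n)
    have "I n - 1 \<le> real (i n)" "\<alpha> * u n - 1 \<le> real (y n)" unfolding i_def y_def by linarith+
    moreover have "I n = ln (real n) / \<nu> - ln (2 * c n) / \<nu> - u n / (2 * \<mu>)"
      using \<mu> \<nu> by (simp add: I_def \<beta>_def diff_divide_distrib power2_eq_square)
    moreover have "\<alpha> * u n = u n / \<mu> - \<delta> * u n" by (simp add: \<alpha>_def left_diff_distrib)
    moreover have "u n / (2 * \<mu>) + u n / (2 * \<mu>) = u n / \<mu>" by simp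
    moreover have "(\<epsilon> - \<delta>) * u n = \<epsilon> * u n - \<delta> * u n" by (simp add: left_diff_distrib)
    moreover have "log (1/p) (real n) + 1/2 * log (p/q) (ln (real n)) - \<epsilon> * ln (ln (real n)) =
        ln (real n) / \<nu> + u n / (2 * \<mu>) - \<epsilon> * u n" by (simp add: L L' u_def)
    ultimately show ?case using elim by simp
  qed
  moreover have "(\<lambda>n. height_cdf (i n + y n) n) \<longlonglongrightarrow> 0"
  proof (rule tendsto_sandwich[OF _ _ tendsto_const])
    show "\<forall>\<^sub>F n in sequentially. 0 \<le> height_cdf (i n + y n) n"
      using height_cdf_nonneg by simp
    define g where "g = (\<lambda>x. (\<beta> * x - 1) * (x - ln (2 * \<nu>) - ln (\<beta> * x)) - \<nu> * (\<alpha> * x * (\<alpha> * x + 3) / 2) - \<tau> * (\<alpha> * x))"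
    \<comment> \<open>As functions of \<open>x = u n\<close>: \<open>g\<close> bounds the logarithm of \<^const>\<open>tall_prob\<close> times the number of
      classes from below, \<open>h\<close> that of the error term, up to the factor \<open>p * q\<close>, from above.\<close>
    define h where "h = (\<lambda>x. (\<beta> * x + 1) * (2 * x) - \<kappa> * x ^ 3)"
    have "filterlim g at_top at_top"
    proof -
      define G where "G = \<beta> - \<nu> * \<alpha>\<^sup>2 / 2"
      have G: "G > 0" using gap by (simp add: G_def)
      have "\<forall>\<^sub>F x in at_top. G * x\<^sup>2 - \<beta> * x * (ln (2 * \<nu>) + ln (\<beta> * x)) - x + ln (2 * \<nu>) + ln (\<beta> * x)
          - \<nu> * (\<alpha> * x * 3 / 2) - \<tau> * (\<alpha> * x) = g x"
        by (intro always_eventually allI) (simp add: g_def G_def power2_eq_square algebra_simps add_divide_distrib diff_divide_distrib)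
      moreover have "filterlim (\<lambda>x. G * x\<^sup>2 - \<beta> * x * (ln (2 * \<nu>) + ln (\<beta> * x)) - x + ln (2 * \<nu>) + ln (\<beta> * x)
          - \<nu> * (\<alpha> * x * 3 / 2) - \<tau> * (\<alpha> * x)) at_top at_top"
        using G \<beta> \<nu> \<alpha> \<tau> by real_asymp
      ultimately show ?thesis
        by (rule filterlim_mono_eventually[OF _ order_refl order_refl, rotated])
    qed
    hence "((\<lambda>x. exp (- exp (g x))) \<longlongrightarrow> 0) at_top"
      by (rule filterlim_compose[rotated]) real_asymp
    moreover have "((\<lambda>x. exp (h x) / (p * q)) \<longlongrightarrow> 0) at_top"
      unfolding h_def using \<beta> \<kappa> p_pos q_pos by real_asymp
    ultimately have "((\<lambda>x. exp (- exp (g x)) + exp (h x) / (p * q)) \<longlongrightarrow> 0) at_top"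
      using tendsto_add by fastforce
    thus "(\<lambda>n. exp (- exp (g (u n))) + exp (h (u n)) / (p * q)) \<longlonglongrightarrow> 0"
      by (rule filterlim_compose[OF _ u_top])
    show "\<forall>\<^sub>F n in sequentially. height_cdf (i n + y n) n \<le> exp (- exp (g (u n))) + exp (h (u n)) / (p * q)"
      using ev
    proof eventually_elim
      case (elim n)
      define t where "t = ln (real n)"
      have ln1: "ln (real n) > 0" using elim by simp
      have t: "t > 0" "ln t = u n" "exp (u n) = t" using ln1 unfolding t_def u_def by (simp_all only: exp_ln)
      have tn: "exp t = real n" using elim by (simp add: t_def)
      have y: "real (y n) \<le> \<alpha> * u n"
      proof -
        have "0 \<le> \<alpha> * u n" using elim \<alpha> by simp
        thus ?thesis unfolding y_def by linarith
      qed
      have j: "real (j n) \<le> \<beta> * u n" "\<beta> * u n - 1 \<le> real (j n)" using elim unfolding j_def by linarith+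
      have j1: "j n \<ge> 1" using elim j(2) by linarith
      have I0: "I n \<ge> 1"
      proof -
        have "t / (2 * \<nu>) \<ge> 0" using t \<nu> by simp
        thus ?thesis using elim unfolding t_def by linarith
      qed
      have i: "real (i n) \<le> I n" "t / (2 * \<nu>) \<le> real (i n)" using elim I0 unfolding i_def t_def by linarith+
      have ji: "j n \<le> i n" using j(1) i(2) elim unfolding t_def by linarith
      have c1: "c n \<ge> 1" using elim by (simp add: c_def)
      have pp: "p ^ r = exp (- (\<nu> * real r))" "q ^ r = exp (- (\<tau> * real r))" for r
        using p_pos q_pos by (simp_all add: \<nu>_def \<tau>_def mult.commute[of "ln _"] exp_of_nat_mult)
      have den: "p ^ (i n - j n) * q ^ j n = exp (- (\<nu> * real (i n) + \<mu> * real (j n)))"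
        unfolding pp exp_add[symmetric] using ji by (simp add: of_nat_diff \<tau>_eq algebra_simps)
      have "2 * c n / (p ^ (i n - j n) * q ^ j n) = exp (ln (2 * c n) + (\<nu> * real (i n) + \<mu> * real (j n)))"
        unfolding den using c1 by (simp only: exp_minus exp_add divide_inverse inverse_inverse_eq) simp
      also have "\<dots> \<le> exp t"
      proof -
        have "\<nu> * real (i n) \<le> \<nu> * I n" "\<mu> * real (j n) \<le> \<mu> * (\<beta> * u n)"
          using i j \<nu> \<mu> by (simp_all only: mult_left_mono less_imp_le)
        moreover have "\<nu> * I n = t - ln (2 * c n) - \<mu> * (\<beta> * u n)" using \<nu> by (simp add: I_def t_def)
        ultimately have "ln (2 * c n) + (\<nu> * real (i n) + \<mu> * real (j n)) \<le> t" by linarith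
        thus ?thesis by simp
      qed
      finally have n: "2 * c n / (p ^ (i n - j n) * q ^ j n) \<le> real n" by (simp only: tn)
      have "exp (g (u n)) \<le> tall_prob (y n) * real (i n choose j n)"
      proof -
        let ?r = "u n - ln (2 * \<nu>) - ln (\<beta> * u n)"
        have r: "?r = ln ((t / (2 * \<nu>)) / (\<beta> * u n))"
          using t \<nu> \<beta> elim by (simp add: ln_div ln_mult_pos)
        have "\<beta> * u n > 0" "\<beta> * u n \<le> t / (2 * \<nu>)" using elim unfolding t_def by linarith+
        hence "1 \<le> (t / (2 * \<nu>)) / (\<beta> * u n)" by (simp only: le_divide_eq_1_pos)
        hence r0: "?r \<ge> 0" unfolding r by simp
        have "exp ?r \<le> real (i n) / real (j n)"
        proof -
          have "exp ?r = (t / (2 * \<nu>)) / (\<beta> * u n)"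
            unfolding r using t \<nu> \<beta> elim by (intro exp_ln divide_pos_pos mult_pos_pos) auto
          also have "\<dots> \<le> real (i n) / real (j n)"
            using i j j1 t \<nu> by (intro frac_le) auto
          finally show ?thesis .
        qed
        hence "exp ?r ^ j n \<le> (real (i n) / real (j n)) ^ j n" by (intro power_mono) auto
        also have "\<dots> \<le> real (i n choose j n)" using binomial_ge_n_over_k_pow_k[OF ji] by simp
        finally have ch: "exp (real (j n) * ?r) \<le> real (i n choose j n)" by (simp only: exp_of_nat_mult)
        have "ln (tall_prob (y n)) = - (\<nu> * (real (y n) * (real (y n) + 3) / 2)) - \<tau> * real (y n)"
          by (simp add: ln_tall_prob \<nu>_def \<tau>_def)
        moreover have "\<nu> * (real (y n) * (real (y n) + 3) / 2) \<le> \<nu> * (\<alpha> * u n * (\<alpha> * u n + 3) / 2)"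
          using y \<nu> by (intro mult_left_mono divide_right_mono mult_mono) auto
        moreover have "\<tau> * real (y n) \<le> \<tau> * (\<alpha> * u n)" using y \<tau> by simp
        moreover have "(\<beta> * u n - 1) * ?r \<le> real (j n) * ?r" using j(2) r0 by (rule mult_right_mono)
        ultimately have "g (u n) \<le> ln (tall_prob (y n)) + real (j n) * ?r"
          unfolding g_def by linarith
        hence "exp (g (u n)) \<le> exp (ln (tall_prob (y n))) * exp (real (j n) * ?r)"
          by (simp add: exp_add[symmetric])
        also have "\<dots> = tall_prob (y n) * exp (real (j n) * ?r)" using tall_prob_pos by simp
        also have "\<dots> \<le> tall_prob (y n) * real (i n choose j n)"
          using ch tall_prob_pos[of "y n"] by (intro mult_left_mono) auto
        finally show ?thesis .
      qed
      moreover have "real ((i n + 2) choose (j n + 1)) * band_error (c n) \<le> exp (h (u n)) / (p * q)"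
      proof -
        have "real ((i n + 2) choose (j n + 1)) \<le> real (i n + 2) ^ (j n + 1)"
          using of_nat_mono[OF binomial_le_pow[of "j n + 1" "i n + 2"], where 'a = real] ji
          by (simp only: of_nat_power)
        also have "\<dots> \<le> (t\<^sup>2) ^ (j n + 1)"
        proof (intro power_mono)
          have "\<mu> * (\<beta> * u n) \<ge> 0" "ln (2 * c n) \<ge> 0" using \<mu> \<beta> elim c1 by auto
          hence "I n \<le> t / \<nu>" unfolding I_def t_def using \<nu> by (intro divide_right_mono) auto
          thus "real (i n + 2) \<le> t\<^sup>2" using i(1) elim by (simp add: t_def)
        qed simp
        also have "\<dots> = exp (real (j n + 1) * (2 * u n))"
        proof -
          have "t\<^sup>2 = exp (2 * u n)" using t by (simp add: exp_double)
          thus ?thesis by (simp only: exp_of_nat_mult)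
        qed
        also have "\<dots> \<le> exp ((\<beta> * u n + 1) * (2 * u n))"
          using j(1) elim by (simp add: mult_right_mono)
        finally have "real ((i n + 2) choose (j n + 1)) * band_error (c n) \<le>
            exp ((\<beta> * u n + 1) * (2 * u n)) * band_error (c n)"
          using band_error_nonneg by (intro mult_right_mono)
        also have "\<dots> = exp (h (u n)) / (p * q)"
          by (simp add: band_error_def h_def \<kappa>_def c_def exp_diff exp_minus divide_inverse)
        finally show ?thesis .
      qed
      moreover have "height_cdf (i n + y n) n \<le> exp (- (tall_prob (y n) * real (i n choose j n))) +
          real ((i n + 2) choose (j n + 1)) * band_error (c n)"
        using n y elim qp ji by (intro height_cdf_le_exp) auto
      moreover have "exp (- (tall_prob (y n) * real (i n choose j n))) \<le> exp (- exp (g (u n)))"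
        using calculation(1) by simp
      ultimately show ?case by linarith
    qed
  qed
  ultimately show ?thesis by (intro exI[of _ "\<lambda>n. i n + y n"] conjI)
qed

end

theorem theorem1:
  fixes p q :: real
    and X :: "nat \<Rightarrow> 'a set" and A :: "nat \<Rightarrow> 'b set" and \<phi> :: "nat \<Rightarrow> 'a \<Rightarrow> 'b"
    and M :: "nat \<Rightarrow> 'w measure" and Q :: "nat \<Rightarrow> nat \<Rightarrow> 'w \<Rightarrow> 'b set"
    and H :: "nat \<Rightarrow> 'w \<Rightarrow> nat"
  assumes p: "1/2 \<le> p" "p < 1" and q: "q = 1 - p"
    and X: "\<And>n. finite (X n)" "\<And>n. card (X n) = n"
    and A: "\<And>n. finite (A n)" "\<And>n. card (A n) = n"
    and \<phi>: "\<And>n. bij_betw (\<phi> n) (X n) (A n)"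
    and process: "\<And>n. renyi_process p (X n) (A n) (\<phi> n) (M n) (Q n)"
    and H: "\<And>n \<omega>. H n \<omega> = renyi_height (X n) (\<phi> n) (\<lambda>j. Q n j \<omega>)"
  shows "(p > q \<longrightarrow>
            whp_eq_plus_smallo M (\<lambda>n \<omega>. real (H n \<omega>))
              (\<lambda>n. log (1/p) (real n) + 1/2 * log (p/q) (ln (real n)))
              (\<lambda>n. ln (ln (real n)))) \<and>
         (p = q \<longrightarrow>
            whp_eq_plus_smallo M (\<lambda>n \<omega>. real (H n \<omega>))
              (\<lambda>n. log 2 (real n) + sqrt (2 * log 2 (real n)))
              (\<lambda>n. sqrt (ln (real n))))"
proof -
  interpret bias p q using p q by unfold_locales auto
  note deviation = prob_height_deviation_tendsto_0[OF X A(1) \<phi> process H]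
  show ?thesis
    unfolding whp_eq_plus_smallo_def
  proof (intro conjI impI allI)
    fix \<epsilon> :: real assume qp: "q < p" and \<epsilon>: "0 < \<epsilon>"
    show "(\<lambda>n. \<P>(\<omega> in M n. \<epsilon> * ln (ln (real n)) <
        \<bar>real (H n \<omega>) - (log (1/p) (real n) + 1/2 * log (p/q) (ln (real n)))\<bar>)) \<longlonglongrightarrow> 0"
      using biased_upper[OF qp \<epsilon>] biased_lower[OF qp \<epsilon>] by (elim exE conjE) (rule deviation)
  next
    fix \<epsilon> :: real assume pq: "p = q" and \<epsilon>: "0 < \<epsilon>"
    show "(\<lambda>n. \<P>(\<omega> in M n. \<epsilon> * sqrt (ln (real n)) <
        \<bar>real (H n \<omega>) - (log 2 (real n) + sqrt (2 * log 2 (real n)))\<bar>)) \<longlonglongrightarrow> 0"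
      using symmetric_upper[OF pq \<epsilon>] symmetric_lower[OF pq \<epsilon>] by (elim exE conjE) (rule deviation)
  qed
qed

end
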